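(* Let $1<p<\infty$, let $q$ be the conjugate exponent of $p$, and let $\{\Lambda_\omega\in B(X,H_\omega):\omega\in\Omega\}$ be a family of bounded operators. (i) Suppose $\{\Lambda_\omega\}_{\omega\in\Omega}$ is a Bochner $pg$-frame for $X$ with respect to $\{H_\omega\}_{\omega\in\Omega}$. Then the operator $T:L^q(\mu,\oplus_{\omega\in\Omega}H_\omega)\to X^*$ given by $\langle x,TG\rangle=\int_\Omega\langle\Lambda_\omega(x),G(\omega)\rangle\,d\mu(\omega)$ is a (well-defined) surjective bounded operator. (ii) Suppose $\mu$ is $\sigma$-finite and for each $x\in X$ the map $\omega\mapsto\Lambda_\omega(x)$ is Bochner measurable. If the operator $T:L^q(\mu,\oplus_{\omega\in\Omega}H_\omega)\to X^*$ given by $\langle x,TG\rangle=\int_\Omega\langle\Lambda_\omega(x),G(\omega)\rangle\,d\mu(\omega)$ is a (well-defined) surjective bounded operator, then $\{\Lambda_\omega\}_{\omega\in\Omega}$ is a Bochner $pg$-frame for $X$ with respect to $\{H_\omega\}_{\omega\in\Omega}$.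
   Context: $X$ is a Banach space, $(\Omega,\Sigma,\mu)$ is a measure space with $\mu$ a positive measure, and $\{H_\omega\}_{\omega\in\Omega}$ is a family of Hilbert spaces. $B(X,H_\omega)$ is the space of bounded linear operators from $X$ to $H_\omega$. Put $K=\oplus_{\omega\in\Omega}H_\omega$ (Hilbert space direct sum), with each $H_\omega$ regarded as a subspace of $K$. A function $f$ from $\Omega$ to a Banach space is Bochner measurable if there are simple functions $f_n$ with $\|f_n(\omega)-f(\omega)\|\to0$ for $\mu$-a.e. $\omega$. For $1\le r<\infty$, $L^r(\mu,K)$ is the Bochner space of (classes of) Bochner measurable $F:\Omega\to K$ with $\|F\|_r=(\int_\Omega\|F(\omega)\|^r d\mu(\omega))^{1/r}<\infty$. Pairing: $\nu:K\to K^*$ is a fixed isometric (linear) isomorphism between $K$ and $K^*$, and for $u,v\in K$, $\langle u,v\rangle:=\nu(v)(u)$ (not the inner product). For $x\in X$, $x^*\in X^*$, $\langle x,x^*\rangle=x^*(x)$. Bochner $pg$-frame ($1<p<\infty$): a family $\{\Lambda_\omega\in B(X,H_\omega)\}_{\omega\in\Omega}$ is a Bochner $pg$-frame for $X$ with respect to $\{H_\omega\}_{\omega\in\Omega}$ if (i) for each $x\in X$, $\omega\mapsto\Lambda_\omega(x)$ is Bochner measurable, and (ii) there are positive constants $A,B$ with $A\|x\|\le(\int_\Omega\|\Lambda_\omega(x)\|^p d\mu(\omega))^{1/p}\le B\|x\|$ for all $x\in X$. "$T$ is well-defined" means that for all $x\in X$ and $G\in L^q(\mu,K)$ the integral defining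 $\langle x,TG\rangle$ exists and is finite, and that $TG\in X^*$. *)

theory Defs
  imports "HOL-Analysis.Analysis"
begin

section \<open>Scalars\<close>

text \<open>
  The scalar field is \<open>\<real>\<close> or \<open>\<complex>\<close>: an isometric and real-linear field embedding into \<open>\<complex>\<close> has
  range \<open>\<real>\<close> or \<open>\<complex>\<close>. The embedding is used to conjugate scalars.
\<close>

class real_or_complex = real_normed_field + banach + second_countable_topology +
  fixes cplx :: "'a \<Rightarrow> complex"
  assumes cplx_add: "cplx (a + b) = cplx a + cplx b"
    and cplx_mult: "cplx (a * b) = cplx a * cplx b"
    and cplx_scaleR: "cplx (r *\<^sub>R a) = r *\<^sub>R cplx a"
    and norm_cplx: "norm (cplx a) = norm a"

instantiation real :: real_or_complex
begin
definition cplx_real :: "real \<Rightarrow> complex" where "cplx_real = complex_of_real"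
instance by standard (auto simp: cplx_real_def scaleR_conv_of_real)
end

instantiation complex :: real_or_complex
begin
definition cplx_complex :: "complex \<Rightarrow> complex" where "cplx_complex = id"
instance by standard (auto simp: cplx_complex_def)
end


section \<open>Banach and Hilbert spaces over the scalar field\<close>

text \<open>
  A Banach space over \<open>'k\<close> is a type of class \<^class>\<open>banach\<close> with a scalar multiplication by
  \<open>'k\<close> that extends the real one and for which the norm is homogeneous. A Hilbert space is a
  Banach space whose norm comes from a \<open>'k\<close>-valued inner product, linear in the first argument.
\<close>

definition scalar_mult :: "('k::real_or_complex \<Rightarrow> 'x::real_normed_vector \<Rightarrow> 'x) \<Rightarrow> bool" where
  "scalar_mult s \<longleftrightarrow> vector_space s \<and> (\<forall>r x. s (of_real r) x = r *\<^sub>R x) \<and>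
     (\<forall>c x. norm (s c x) = norm c * norm x)"

definition inner_product ::
  "('k::real_or_complex \<Rightarrow> 'h::real_normed_vector \<Rightarrow> 'h) \<Rightarrow> ('h \<Rightarrow> 'h \<Rightarrow> 'k) \<Rightarrow> bool" where
  "inner_product s ip \<longleftrightarrow>
     (\<forall>u v w. ip (u + v) w = ip u w + ip v w) \<and>
     (\<forall>c u v. ip (s c u) v = c * ip u v) \<and>
     (\<forall>u v. cplx (ip v u) = cnj (cplx (ip u v))) \<and>
     (\<forall>u. ip u u = of_real ((norm u)\<^sup>2))"

text \<open>
  The whole space is the Hilbert space direct sum of the subspaces \<open>H i\<close>, \<open>i \<in> I\<close>. Every family of
  Hilbert spaces is of this form, with the summands identified with their copies in the sum.
\<close>

definition hilbert_direct_sum ::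
  "('k::real_or_complex \<Rightarrow> 'h::real_normed_vector \<Rightarrow> 'h) \<Rightarrow> ('h \<Rightarrow> 'h \<Rightarrow> 'k) \<Rightarrow>
     'i set \<Rightarrow> ('i \<Rightarrow> 'h set) \<Rightarrow> bool" where
  "hilbert_direct_sum s ip I H \<longleftrightarrow>
     (\<forall>i\<in>I. module.subspace s (H i) \<and> closed (H i)) \<and>
     (\<forall>i\<in>I. \<forall>j\<in>I. i \<noteq> j \<longrightarrow> (\<forall>u\<in>H i. \<forall>v\<in>H j. ip u v = 0)) \<and>
     closure (module.span s (\<Union>i\<in>I. H i)) = UNIV"

text \<open>
  \<^const>\<open>bounded_linear\<close> is real-linearity and boundedness, so linearity over \<open>'k\<close> is added.
\<close>

definition bounded_operators ::
  "('k \<Rightarrow> 'x::real_normed_vector \<Rightarrow> 'x) \<Rightarrow> ('k::real_or_complex \<Rightarrow> 'y::real_normed_vector \<Rightarrow> 'y) \<Rightarrow>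
     'y set \<Rightarrow> ('x \<Rightarrow> 'y) set" where
  "bounded_operators s t Y = {f. bounded_linear f \<and> (\<forall>c x. f (s c x) = t c (f x)) \<and> range f \<subseteq> Y}"

abbreviation dual_space ::
  "('k::real_or_complex \<Rightarrow> 'x::real_normed_vector \<Rightarrow> 'x) \<Rightarrow> ('x \<Rightarrow> 'k) set" where
  "dual_space s \<equiv> bounded_operators s (*) UNIV"

definition isometric_iso_to_dual ::
  "('k::real_or_complex \<Rightarrow> 'h::real_normed_vector \<Rightarrow> 'h) \<Rightarrow> ('h \<Rightarrow> 'h \<Rightarrow> 'k) \<Rightarrow> bool" where
  "isometric_iso_to_dual s \<nu> \<longleftrightarrow>
     bij_betw \<nu> UNIV (dual_space s) \<and>
     (\<forall>u v. \<nu> (u + v) = (\<lambda>w. \<nu> u w + \<nu> v w)) \<and>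
     (\<forall>c v. \<nu> (s c v) = (\<lambda>w. c * \<nu> v w)) \<and>
     (\<forall>v. onorm (\<nu> v) = norm v)"

definition pairing :: "('h \<Rightarrow> 'h \<Rightarrow> 'k) \<Rightarrow> 'h \<Rightarrow> 'h \<Rightarrow> 'k" where
  "pairing \<nu> u v = \<nu> v u"


section \<open>Bochner spaces\<close>

definition bochner_measurable :: "'w measure \<Rightarrow> ('w \<Rightarrow> 'b::real_normed_vector) \<Rightarrow> bool" where
  "bochner_measurable M f \<longleftrightarrow>
     (\<exists>s. (\<forall>n::nat. simple_function M (s n)) \<and>
          (AE \<omega> in M. (\<lambda>n. norm (s n \<omega> - f \<omega>)) \<longlonglongrightarrow> 0))"

text \<open>
  Elements of \<open>L\<^sup>r\<close> are represented by functions, equality in \<open>L\<^sup>r\<close> being equality almost everywhere.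
\<close>

definition Lr :: "'w measure \<Rightarrow> real \<Rightarrow> ('w \<Rightarrow> 'b::real_normed_vector) set" where
  "Lr M r = {F. bochner_measurable M F \<and> (\<integral>\<^sup>+\<omega>. ennreal (norm (F \<omega>) powr r) \<partial>M) < \<infinity>}"

definition Lr_norm :: "'w measure \<Rightarrow> real \<Rightarrow> ('w \<Rightarrow> 'b::real_normed_vector) \<Rightarrow> real" where
  "Lr_norm M r F = enn2real (\<integral>\<^sup>+\<omega>. ennreal (norm (F \<omega>) powr r) \<partial>M) powr (1 / r)"

text \<open>A bounded linear operator from \<open>L\<^sup>r\<close> to the dual space, given on representatives.\<close>

definition bounded_operator_Lr_dual ::
  "'w measure \<Rightarrow> real \<Rightarrow> ('k::real_or_complex \<Rightarrow> 'h::real_normed_vector \<Rightarrow> 'h) \<Rightarrow>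
     ('k \<Rightarrow> 'x::real_normed_vector \<Rightarrow> 'x) \<Rightarrow> (('w \<Rightarrow> 'h) \<Rightarrow> 'x \<Rightarrow> 'k) \<Rightarrow> bool" where
  "bounded_operator_Lr_dual M r sK sX T \<longleftrightarrow>
     (\<forall>G\<in>Lr M r. T G \<in> dual_space sX) \<and>
     (\<forall>F\<in>Lr M r. \<forall>G\<in>Lr M r. (AE \<omega> in M. F \<omega> = G \<omega>) \<longrightarrow> T F = T G) \<and>
     (\<forall>F\<in>Lr M r. \<forall>G\<in>Lr M r. T (\<lambda>\<omega>. F \<omega> + G \<omega>) = (\<lambda>x. T F x + T G x)) \<and>
     (\<forall>c. \<forall>G\<in>Lr M r. T (\<lambda>\<omega>. sK c (G \<omega>)) = (\<lambda>x. c * T G x)) \<and>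
     (\<exists>C. \<forall>G\<in>Lr M r. onorm (T G) \<le> C * Lr_norm M r G)"


section \<open>Bochner pg-frames and the synthesis operator\<close>

definition bochner_pg_frame ::
  "'w measure \<Rightarrow> real \<Rightarrow> ('k::real_or_complex \<Rightarrow> 'x::real_normed_vector \<Rightarrow> 'x) \<Rightarrow>
     ('k \<Rightarrow> 'h::real_normed_vector \<Rightarrow> 'h) \<Rightarrow> ('w \<Rightarrow> 'h set) \<Rightarrow> ('w \<Rightarrow> 'x \<Rightarrow> 'h) \<Rightarrow> bool" where
  "bochner_pg_frame M p sX sK H \<Lambda> \<longleftrightarrow>
     (\<forall>\<omega>\<in>space M. \<Lambda> \<omega> \<in> bounded_operators sX sK (H \<omega>)) \<and>
     (\<forall>x. bochner_measurable M (\<lambda>\<omega>. \<Lambda> \<omega> x)) \<and>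
     (\<exists>A>0. \<exists>B>0. \<forall>x.
        (\<integral>\<^sup>+\<omega>. ennreal (norm (\<Lambda> \<omega> x) powr p) \<partial>M) < \<infinity> \<and>
        A * norm x \<le> Lr_norm M p (\<lambda>\<omega>. \<Lambda> \<omega> x) \<and>
        Lr_norm M p (\<lambda>\<omega>. \<Lambda> \<omega> x) \<le> B * norm x)"

text \<open>
  A limit almost everywhere of simple functions need only agree almost everywhere with a Borel
  function, and \<^const>\<open>lebesgue_integral\<close> is \<open>0\<close> on functions that are not Borel. So scalar integrals
  are taken with respect to the completion of \<open>M\<close>, which changes nothing for Borel integrands.
\<close>

definition synthesis ::
  "'w measure \<Rightarrow> ('h \<Rightarrow> 'h \<Rightarrow> 'k::real_or_complex) \<Rightarrow> ('w \<Rightarrow> 'x \<Rightarrow> 'h) \<Rightarrow> ('w \<Rightarrow> 'h) \<Rightarrow> 'x \<Rightarrow> 'k" where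
  "synthesis M \<nu> \<Lambda> G = (\<lambda>x. \<integral>\<omega>. pairing \<nu> (\<Lambda> \<omega> x) (G \<omega>) \<partial>completion M)"

definition synthesis_well_defined ::
  "'w measure \<Rightarrow> real \<Rightarrow> ('k::real_or_complex \<Rightarrow> 'x::real_normed_vector \<Rightarrow> 'x) \<Rightarrow>
     ('h::real_normed_vector \<Rightarrow> 'h \<Rightarrow> 'k) \<Rightarrow> ('w \<Rightarrow> 'x \<Rightarrow> 'h) \<Rightarrow> bool" where
  "synthesis_well_defined M q sX \<nu> \<Lambda> \<longleftrightarrow>
     (\<forall>G\<in>Lr M q.
        (\<forall>x. integrable (completion M) (\<lambda>\<omega>. pairing \<nu> (\<Lambda> \<omega> x) (G \<omega>))) \<and>
        synthesis M \<nu> \<Lambda> G \<in> dual_space sX)"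

text \<open>The operator \<open>T : L\<^sup>q \<rightarrow> X\<^sup>*\<close> is well-defined, bounded and surjective.\<close>

definition synthesis_surjective_bounded ::
  "'w measure \<Rightarrow> real \<Rightarrow> ('k::real_or_complex \<Rightarrow> 'x::real_normed_vector \<Rightarrow> 'x) \<Rightarrow>
     ('k \<Rightarrow> 'h::real_normed_vector \<Rightarrow> 'h) \<Rightarrow> ('h \<Rightarrow> 'h \<Rightarrow> 'k) \<Rightarrow> ('w \<Rightarrow> 'x \<Rightarrow> 'h) \<Rightarrow> bool" where
  "synthesis_surjective_bounded M q sX sK \<nu> \<Lambda> \<longleftrightarrow>
     synthesis_well_defined M q sX \<nu> \<Lambda> \<and>
     bounded_operator_Lr_dual M q sK sX (synthesis M \<nu> \<Lambda>) \<and>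
     synthesis M \<nu> \<Lambda> ` Lr M q = dual_space sX"

end

theory Submission
  imports Defs
begin

text \<open>
  Write \<open>U x = (\<omega> \<mapsto> \<Lambda> \<omega> x)\<close> for the analysis operator, so that the synthesis operator \<open>T\<close> is the
  adjoint of \<open>U\<close> with respect to the pairing of \<open>L\<^sup>p\<close> with \<open>L\<^sup>q\<close>. A frame is a family for which \<open>U\<close> is
  bounded and bounded below as a map into \<open>L\<^sup>p\<close>.

  Frame implies surjective. Boundedness of \<open>T\<close> is Hoelder's inequality. For surjectivity let \<open>\<phi>\<close> be
  a functional on \<open>X\<close>, and minimise
  \<open>x \<mapsto> (\<integral> |\<Lambda> \<omega> x|\<^sup>p) / p - Re \<phi> x\<close> over \<open>X\<close> itself. The lower frame bound makes this functional
  coercive, and the parallelogram identity in \<open>K\<close> makes it uniformly convex, so minimising sequences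
  are Cauchy and a minimiser \<open>v\<close> exists because \<open>X\<close> is complete (lemma \<open>subgradient_map_onto\<close>).
  The Euler equation at \<open>v\<close> says that \<open>\<phi> = T G\<close> for \<open>G \<omega> = |\<Lambda> \<omega> v|\<^bsup>p-2\<^esup> J (\<Lambda> \<omega> v)\<close>, where \<open>J\<close>
  carries \<open>w\<close> to the vector that pairs with \<open>u\<close> to the inner product of \<open>u\<close> and \<open>w\<close>
  (lemma \<open>synthesis_surjective\<close>).

  Surjective implies frame. The upper bound tests \<open>T\<close> on the functions \<open>G\<close> just described, built
  from truncations of \<open>U x\<close> to sets of finite measure on which it is bounded: such a test recovers
  the \<open>L\<^sup>p\<close> norm of the truncation, and \<open>\<sigma>\<close>-finiteness lets the truncations increase to \<open>U x\<close>
  (lemma \<open>upper_bound_if_synthesis_bounded\<close>). For the lower bound, every functional on \<open>X\<close> is some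
  \<open>T G\<close> and is therefore at most the \<open>L\<^sup>q\<close> norm of \<open>G\<close> on the set of all \<open>x\<close> for which \<open>U x\<close> has
  norm at most \<open>1\<close>. So this set is weakly bounded, hence bounded by the uniform boundedness principle
  and the Hahn-Banach theorem (lemma \<open>lower_bound_if_synthesis_surjective\<close>).
\<close>


section \<open>Convexity of powers\<close>

lemma conjugate_exponent:
  fixes p q :: real
  assumes "1 < p" "1 / p + 1 / q = 1"
  shows "1 < q" "(p - 1) * q = p"
proof -
  have "q \<noteq> 0"
    using assms by auto
  then have *: "p + q = p * q"
    using assms by (simp add: field_simps)
  then have "q * (p - 1) = p"
    by (simp add: algebra_simps)
  then have "q = p / (p - 1)"
    using assms(1) by (simp add: field_simps)
  then show "1 < q"
    using assms(1) by simp
  show "(p - 1) * q = p"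
    using * by (simp add: algebra_simps)
qed

text \<open>
  By the mean value theorem: the derivative of the power is larger on the right half of the interval
  than on the left half.
\<close>

lemma powr_midpoint_strict:
  fixes p s t :: real
  assumes p: "1 < p" and st: "0 \<le> s" "s < t"
  shows "((s + t) / 2) powr p < (s powr p + t powr p) / 2"
proof -
  define c where "c = (s + t) / 2"
  have c: "s < c" "c < t" "c - s = t - c"
    using st by (auto simp: c_def field_simps)
  have cont: "continuous_on {a..b} (\<lambda>x::real. x powr p)" if "0 \<le> a" for a b
    using that p by (intro continuous_on_powr' continuous_intros) auto
  have der: "((\<lambda>x. x powr p) has_real_derivative p * x powr (p - 1)) (at x)" if "0 < x" for x :: real
    using that by (rule has_real_derivative_powr)
  have mvt: "\<exists>x. a < x \<and> x < b \<and> b powr p - a powr p = (b - a) * (p * x powr (p - 1))"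
    if ab: "0 \<le> a" "a < b" for a b :: real
  proof -
    have "(\<lambda>x. x powr p) differentiable (at x)" if "a < x" for x
      using der[of x] that ab(1) real_differentiable_def by force
    then obtain l x where x: "a < x" "x < b" "((\<lambda>x. x powr p) has_real_derivative l) (at x)"
        "b powr p - a powr p = (b - a) * l"
      using MVT[OF ab(2) cont[OF ab(1)]] by blast
    then have "l = p * x powr (p - 1)"
      using der[of x] ab(1) by (intro DERIV_unique) auto
    with x show ?thesis
      by blast
  qed
  obtain x where x: "s < x" "x < c" "c powr p - s powr p = (c - s) * (p * x powr (p - 1))"
    using mvt[of s c] st c by auto
  obtain y where y: "c < y" "y < t" "t powr p - c powr p = (t - c) * (p * y powr (p - 1))"
    using mvt[of c t] st c by auto
  have "x powr (p - 1) < y powr (p - 1)"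
    using x y st p by (intro powr_less_mono2) auto
  then have "(c - s) * (p * x powr (p - 1)) < (t - c) * (p * y powr (p - 1))"
    unfolding c(3) using c p by simp
  then show ?thesis
    unfolding c_def[symmetric] using x(3) y(3) by simp
qed

lemma square_powr_half:
  fixes x p :: real
  assumes "0 \<le> x"
  shows "(x\<^sup>2) powr (p / 2) = x powr p"
proof -
  have "x\<^sup>2 = x powr 2"
    using assms by simp
  then show ?thesis
    by (simp only: powr_powr) simp
qed

text \<open>
  For vectors of norms \<open>s\<close> and \<open>t\<close> at distance \<open>d\<close> in a Hilbert space, \<open>w\<close> is the squared norm of
  the midpoint. The gap is strict because either the norms differ, and the power is strictly convex,
  or they agree, and then the midpoint is strictly shorter. The bound \<open>\<bar>s - t\<bar> \<le> d\<close> is essential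
  when \<open>p < 2\<close>.
\<close>

lemma midpoint_defect:
  fixes p s t d :: real
  assumes p: "1 < p" and st: "0 \<le> s" "0 \<le> t" and d: "\<bar>s - t\<bar> \<le> d" "d \<le> s + t"
  defines "w \<equiv> (s\<^sup>2 + t\<^sup>2) / 2 - d\<^sup>2 / 4"
  shows "0 \<le> w" "w powr (p / 2) \<le> (s powr p + t powr p) / 2"
    "0 < d \<Longrightarrow> w powr (p / 2) < (s powr p + t powr p) / 2"
proof -
  define c where "c = (s + t) / 2"
  have c: "0 \<le> c"
    using st by (simp add: c_def)
  have "(s - t)\<^sup>2 \<le> d\<^sup>2" "d\<^sup>2 \<le> (s + t)\<^sup>2"
    using d abs_le_square_iff[of "s - t" d] by (auto intro: power_mono)
  moreover have "(s - t)\<^sup>2 = 2 * s\<^sup>2 + 2 * t\<^sup>2 - 4 * c\<^sup>2" "(s + t)\<^sup>2 = 4 * c\<^sup>2"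
    by (auto simp: c_def power2_eq_square field_simps)
  ultimately have "2 * s\<^sup>2 + 2 * t\<^sup>2 - 4 * c\<^sup>2 \<le> d\<^sup>2" "d\<^sup>2 \<le> 4 * c\<^sup>2"
      "0 \<le> 2 * s\<^sup>2 + 2 * t\<^sup>2 - 4 * c\<^sup>2"
    using zero_le_power2[of "s - t"] by simp_all
  moreover have "w = (2 * s\<^sup>2 + 2 * t\<^sup>2 - d\<^sup>2) / 4"
    by (simp add: w_def field_simps)
  ultimately have w: "w \<le> c\<^sup>2" and w0: "0 \<le> w"
    by simp_all
  show "0 \<le> w"
    by (rule w0)
  have wc: "w powr (p / 2) \<le> c powr p"
    using powr_mono2[OF _ w0 w, of "p / 2"] p square_powr_half[OF c, of p] by simp
  have strict: "c powr p < (s powr p + t powr p) / 2" if "s \<noteq> t"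
  proof (cases "s < t")
    case True
    then show ?thesis
      using powr_midpoint_strict[OF p st(1) True] by (simp add: c_def)
  next
    case False
    then show ?thesis
      using powr_midpoint_strict[OF p st(2), of s] that by (simp add: c_def add.commute)
  qed
  show "w powr (p / 2) \<le> (s powr p + t powr p) / 2"
    using wc strict by (cases "s = t") (auto simp: c_def)
  show "w powr (p / 2) < (s powr p + t powr p) / 2" if "0 < d"
  proof (cases "s = t")
    case True
    then have "w < c\<^sup>2"
      using that by (simp add: w_def c_def)
    then have "w powr (p / 2) < (c\<^sup>2) powr (p / 2)"
      using p w0 by (intro powr_less_mono2) auto
    then have "w powr (p / 2) < c powr p"
      by (simp only: square_powr_half[OF c])
    then show ?thesis
      using True by (simp add: c_def)
  qed (use wc strict in auto)
qed

text \<open>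
  Compactness: where the distance is not small, the midpoint gap is continuous and positive on a
  compact set of triples \<open>(s, t, d)\<close>, so it has a positive minimum.
\<close>

lemma uniform_convexity_normalised:
  fixes p \<epsilon> :: real
  assumes p: "1 < p" and \<epsilon>: "0 < \<epsilon>"
  obtains C where "0 < C"
    "\<And>s t d. 0 \<le> s \<Longrightarrow> 0 \<le> t \<Longrightarrow> s powr p + t powr p = 1 \<Longrightarrow> \<bar>s - t\<bar> \<le> d \<Longrightarrow> d \<le> s + t \<Longrightarrow>
       d powr p \<le> \<epsilon> + C * (1 / 2 - ((s\<^sup>2 + t\<^sup>2) / 2 - d\<^sup>2 / 4) powr (p / 2))"
proof -
  define defect :: "real \<times> real \<times> real \<Rightarrow> real" where
    "defect = (\<lambda>(s, t, d). 1 / 2 - \<bar>(s\<^sup>2 + t\<^sup>2) / 2 - d\<^sup>2 / 4\<bar> powr (p / 2))"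
  \<comment> \<open>The absolute values make the powers continuous on the whole space; on \<open>P\<close> they change nothing.\<close>
  define P where "P = {(s, t, d). 0 \<le> s \<and> 0 \<le> t \<and> \<bar>s\<bar> powr p + \<bar>t\<bar> powr p = 1 \<and> \<bar>s - t\<bar> \<le> d \<and>
      d \<le> s + t \<and> \<epsilon> \<le> \<bar>d\<bar> powr p}"
  have le1: "x \<le> 1" if "0 \<le> x" "0 \<le> y" "x powr p + y powr p = 1" for x y :: real
  proof (rule ccontr)
    assume "\<not> x \<le> 1"
    then have "1 powr p < x powr p"
      using p by (intro powr_less_mono2) auto
    then show False
      using that(3) powr_ge_zero[of y p] by simp
  qed
  have cont: "continuous_on UNIV (\<lambda>z. \<bar>f z\<bar> powr r)"
    if "continuous_on UNIV f" "0 < r" for f :: "real \<times> real \<times> real \<Rightarrow> real" and r :: real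
    using that by (intro continuous_on_powr' continuous_intros) auto
  have bounds: "s \<le> 1" "t \<le> 1" "0 \<le> d" "d \<le> 2" if "(s, t, d) \<in> P" for s t d
  proof -
    have *: "0 \<le> s" "0 \<le> t" "s powr p + t powr p = 1" "\<bar>s - t\<bar> \<le> d" "d \<le> s + t"
      using that unfolding P_def by force+
    show "s \<le> 1" "t \<le> 1"
      using le1[OF *(1,2,3)] le1[OF *(2,1)] *(3) by (simp_all add: add.commute)
    with * show "0 \<le> d" "d \<le> 2"
      by linarith+
  qed
  have "compact P"
  proof -
    have "z \<in> {0..1} \<times> {0..1} \<times> {0..2}" if "z \<in> P" for z
    proof -
      obtain s t d where z: "z = (s, t, d)"
        by (cases z)
      then have P: "(s, t, d) \<in> P"
        using that by simp
      then have "0 \<le> s" "0 \<le> t"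
        by (simp_all add: P_def)
      with bounds[OF P] show ?thesis
        by (simp add: z)
    qed
    then have "P \<subseteq> {0..1} \<times> {0..1} \<times> {0..2}"
      by blast
    moreover have "bounded ({0..1} \<times> {0..1} \<times> {0..2::real} :: (real \<times> real \<times> real) set)"
      by (intro bounded_Times) auto
    moreover have "P = {z. 0 \<le> fst z} \<inter> {z. 0 \<le> fst (snd z)} \<inter>
        {z. \<bar>fst z\<bar> powr p + \<bar>fst (snd z)\<bar> powr p = 1} \<inter>
        {z. \<bar>fst z - fst (snd z)\<bar> \<le> snd (snd z)} \<inter> {z. snd (snd z) \<le> fst z + fst (snd z)} \<inter>
        {z. \<epsilon> \<le> \<bar>snd (snd z)\<bar> powr p}"
      by (auto simp: P_def)
    moreover have "closed \<dots>"
    proof -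
      have powr: "continuous_on UNIV (\<lambda>z :: real \<times> real \<times> real. \<bar>fst z\<bar> powr p)"
        "continuous_on UNIV (\<lambda>z :: real \<times> real \<times> real. \<bar>fst (snd z)\<bar> powr p)"
        "continuous_on UNIV (\<lambda>z :: real \<times> real \<times> real. \<bar>snd (snd z)\<bar> powr p)"
        using p by (auto intro!: cont continuous_on_fst continuous_on_snd continuous_on_id)
      show ?thesis
        by (intro closed_Int closed_Collect_le closed_Collect_eq continuous_on_add powr
            continuous_on_fst continuous_on_snd continuous_on_id continuous_on_const
            continuous_on_diff continuous_on_rabs)
    qed
    ultimately show ?thesis
      by (metis bounded_subset compact_eq_bounded_closed)
  qed
  have pos: "0 < defect z" if z: "z \<in> P" for z
  proof -
    obtain s t d where zz: "z = (s, t, d)"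
      by (cases z)
    have *: "0 \<le> s" "0 \<le> t" "\<bar>s - t\<bar> \<le> d" "d \<le> s + t" "s powr p + t powr p = 1" "\<epsilon> \<le> \<bar>d\<bar> powr p"
      using z by (auto simp: zz P_def)
    have "d \<noteq> 0"
      using * \<epsilon> by auto
    then have "0 < d"
      using *(3) by simp
    then show ?thesis
      using midpoint_defect[OF p *(1,2,3,4)] *(5) by (simp add: zz defect_def)
  qed
  have "continuous_on UNIV defect"
    unfolding defect_def case_prod_beta using p
    by (intro continuous_on_diff continuous_on_const cont continuous_on_divide continuous_on_add
        continuous_on_power continuous_on_fst continuous_on_snd continuous_on_id) auto
  then have "continuous_on P defect"
    by (rule continuous_on_subset) auto
  then obtain c where c: "0 < c" "\<And>z. z \<in> P \<Longrightarrow> c \<le> defect z"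
  proof (cases "P = {}")
    case False
    then obtain z0 where "z0 \<in> P" "\<And>z. z \<in> P \<Longrightarrow> defect z0 \<le> defect z"
      using continuous_attains_inf[OF \<open>compact P\<close> _ \<open>continuous_on P defect\<close>] by blast
    then show ?thesis
      using that pos by blast
  qed (use that[of 1] in auto)
  show ?thesis
  proof (rule that[of "2 powr p / c"])
    show "0 < 2 powr p / c"
      using c(1) by simp
  next
    fix s t d :: real
    assume st: "0 \<le> s" "0 \<le> t" "s powr p + t powr p = 1" and d: "\<bar>s - t\<bar> \<le> d" "d \<le> s + t"
    define w where "w = (s\<^sup>2 + t\<^sup>2) / 2 - d\<^sup>2 / 4"
    have w: "0 \<le> w" "w powr (p / 2) \<le> 1 / 2"
      using midpoint_defect[OF p st(1,2) d] st(3) by (auto simp: w_def)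
    have "d powr p \<le> \<epsilon> + 2 powr p / c * (1 / 2 - w powr (p / 2))"
    proof (cases "d powr p \<le> \<epsilon>")
      case True
      moreover have "0 \<le> 2 powr p / c * (1 / 2 - w powr (p / 2))"
        using c(1) w(2) by (intro mult_nonneg_nonneg) auto
      ultimately show ?thesis
        by linarith
    next
      case False
      then have P: "(s, t, d) \<in> P"
        using st d by (auto simp: P_def)
      then have "c \<le> 1 / 2 - w powr (p / 2)"
        using c(2)[OF P] w(1) by (simp add: defect_def w_def)
      then have "2 powr p / c * c \<le> 2 powr p / c * (1 / 2 - w powr (p / 2))"
        using c(1) by (intro mult_left_mono) auto
      moreover have "d powr p \<le> 2 powr p"
        using bounds[OF P] p by (intro powr_mono2) auto
      ultimately show ?thesis
        using c(1) \<epsilon> by simp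
    qed
    then show "d powr p \<le> \<epsilon> + 2 powr p / c * (1 / 2 - ((s\<^sup>2 + t\<^sup>2) / 2 - d\<^sup>2 / 4) powr (p / 2))"
      by (simp add: w_def)
  qed
qed

text \<open>
  The normalised inequality, rescaled. It is stated for the four norms of \<open>x\<close>, \<open>y\<close>, \<open>x - y\<close> and
  \<open>(x + y) / 2\<close>, which are tied by the parallelogram identity, so that integrating it pointwise shows
  uniform convexity of the norm in \<open>L\<^sup>p\<close>.
\<close>

lemma uniform_convexity:
  fixes p \<epsilon> :: real
  assumes p: "1 < p" and \<epsilon>: "0 < \<epsilon>"
  obtains C where "0 < C"
    "\<And>a b d m. 0 \<le> a \<Longrightarrow> 0 \<le> b \<Longrightarrow> 0 \<le> m \<Longrightarrow> \<bar>a - b\<bar> \<le> d \<Longrightarrow> d \<le> a + b \<Longrightarrow>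
       m\<^sup>2 = (a\<^sup>2 + b\<^sup>2) / 2 - d\<^sup>2 / 4 \<Longrightarrow>
       d powr p \<le> \<epsilon> * (a powr p + b powr p) + C * ((a powr p + b powr p) / 2 - m powr p)"
proof -
  obtain C where C: "0 < C"
    "\<And>s t d. 0 \<le> s \<Longrightarrow> 0 \<le> t \<Longrightarrow> s powr p + t powr p = 1 \<Longrightarrow> \<bar>s - t\<bar> \<le> d \<Longrightarrow> d \<le> s + t \<Longrightarrow>
       d powr p \<le> \<epsilon> + C * (1 / 2 - ((s\<^sup>2 + t\<^sup>2) / 2 - d\<^sup>2 / 4) powr (p / 2))"
    using uniform_convexity_normalised[OF p \<epsilon>] by blast
  show ?thesis
  proof (rule that[OF C(1)])
    fix a b d m :: real
    assume ab: "0 \<le> a" "0 \<le> b" and m: "0 \<le> m" and d: "\<bar>a - b\<bar> \<le> d" "d \<le> a + b"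
      and m2: "m\<^sup>2 = (a\<^sup>2 + b\<^sup>2) / 2 - d\<^sup>2 / 4"
    define S where "S = a powr p + b powr p"
    show "d powr p \<le> \<epsilon> * (a powr p + b powr p) + C * ((a powr p + b powr p) / 2 - m powr p)"
    proof (cases "S = 0")
      case True
      then have "a powr p = 0" "b powr p = 0"
        using powr_ge_zero[of a p] powr_ge_zero[of b p] unfolding S_def by linarith+
      then have "a = 0" "b = 0"
        by auto
      then show ?thesis
        using d m2 m by simp
    next
      case False
      then have S: "0 < S"
        using powr_ge_zero[of a p] powr_ge_zero[of b p] unfolding S_def by linarith
      define L where "L = S powr (1 / p)"
      have L: "0 < L" "L powr p = S"
        using S p by (auto simp: L_def powr_powr)
      have scale: "(x / L) powr p = x powr p / S" if "0 \<le> x" for x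
        using that L by (simp add: powr_divide)
      have "((a / L)\<^sup>2 + (b / L)\<^sup>2) / 2 - (d / L)\<^sup>2 / 4 = (m / L)\<^sup>2"
        unfolding power_divide m2 by (simp add: diff_divide_distrib add_divide_distrib)
      moreover have "((m / L)\<^sup>2) powr (p / 2) = m powr p / S"
        using m L(1) by (subst square_powr_half) (simp_all add: scale)
      moreover have "(a / L) powr p + (b / L) powr p = 1"
        using ab S by (simp add: scale S_def add_divide_distrib[symmetric])
      moreover have "\<bar>a / L - b / L\<bar> \<le> d / L" "d / L \<le> a / L + b / L"
        unfolding diff_divide_distrib[symmetric] add_divide_distrib[symmetric] abs_div_pos[OF L(1), symmetric]
        using d L(1) by (auto intro: divide_right_mono)
      ultimately have "(d / L) powr p \<le> \<epsilon> + C * (1 / 2 - m powr p / S)"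
        using C(2)[of "a / L" "b / L" "d / L"] ab L(1) by simp
      moreover have "0 \<le> d"
        using d by linarith
      ultimately have "d powr p / S \<le> \<epsilon> + C * (1 / 2 - m powr p / S)"
        by (simp add: scale)
      then have "d powr p \<le> (\<epsilon> + C * (1 / 2 - m powr p / S)) * S"
        using S by (simp add: pos_divide_le_eq)
      also have "\<dots> = \<epsilon> * S + C * (S / 2 - m powr p)"
        using S by (simp add: field_simps)
      finally show ?thesis
        by (simp add: S_def)
    qed
  qed
qed

lemma add_powr_le:
  fixes a b p :: real
  assumes p: "1 < p" and ab: "0 \<le> a" "0 \<le> b"
  shows "(a + b) powr p \<le> 2 powr p * (a powr p + b powr p)"
proof -
  have "a + b \<le> 2 * max a b"
    by simp
  then have "(a + b) powr p \<le> (2 * max a b) powr p"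
    using p ab by (intro powr_mono2) auto
  also have "\<dots> = 2 powr p * max a b powr p"
    using ab by (intro powr_mult) 
  also have "\<dots> \<le> 2 powr p * (a powr p + b powr p)"
    by (intro mult_left_mono) (auto simp: max_def)
  finally show ?thesis .
qed

text \<open>
  Young's inequality for the normalised functions. A norm may vanish, so the functions are divided
  by their norms plus \<open>e\<close>, and \<open>e\<close> tends to \<open>0\<close> at the end.
\<close>

lemma Hoelder_inequality:
  fixes f g :: "'w \<Rightarrow> real" and p q :: real
  assumes p: "1 < p" and q: "1 < q" and pq: "1 / p + 1 / q = 1"
    and f: "f \<in> borel_measurable M" "\<And>\<omega>. 0 \<le> f \<omega>" "integrable M (\<lambda>\<omega>. f \<omega> powr p)"
    and g: "g \<in> borel_measurable M" "\<And>\<omega>. 0 \<le> g \<omega>" "integrable M (\<lambda>\<omega>. g \<omega> powr q)"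
  shows "integrable M (\<lambda>\<omega>. f \<omega> * g \<omega>)"
    and "(\<integral>\<omega>. f \<omega> * g \<omega> \<partial>M) \<le>
      (\<integral>\<omega>. f \<omega> powr p \<partial>M) powr (1 / p) * (\<integral>\<omega>. g \<omega> powr q \<partial>M) powr (1 / q)"
proof -
  define a where "a = (\<integral>\<omega>. f \<omega> powr p \<partial>M) powr (1 / p)"
  define b where "b = (\<integral>\<omega>. g \<omega> powr q \<partial>M) powr (1 / q)"
  show int: "integrable M (\<lambda>\<omega>. f \<omega> * g \<omega>)"
  proof (rule Bochner_Integration.integrable_bound)
    show "integrable M (\<lambda>\<omega>. f \<omega> powr p / p + g \<omega> powr q / q)"
      using f g by auto
    show "AE \<omega> in M. norm (f \<omega> * g \<omega>) \<le> norm (f \<omega> powr p / p + g \<omega> powr q / q)"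
      using Youngs_inequality[OF p q pq] f g by (intro always_eventually allI) (auto simp: abs_of_nonneg intro: order_trans[OF _ abs_ge_self])
  qed (use f g in auto)
  have ab: "0 \<le> a" "0 \<le> b"
    by (auto simp: a_def b_def)
  have powers: "a powr p = (\<integral>\<omega>. f \<omega> powr p \<partial>M)" "b powr q = (\<integral>\<omega>. g \<omega> powr q \<partial>M)"
    using p q by (auto simp: a_def b_def powr_powr)
  have shifted: "(\<integral>\<omega>. f \<omega> * g \<omega> \<partial>M) \<le> (a + e) * (b + e)" if e: "0 < e" for e
  proof -
    define s t where "s = a + e" and "t = b + e"
    have st: "0 < s" "0 < t" "a \<le> s" "b \<le> t"
      using ab e by (auto simp: s_def t_def)
    have "(\<integral>\<omega>. f \<omega> * g \<omega> \<partial>M) / (s * t) = (\<integral>\<omega>. (f \<omega> / s) * (g \<omega> / t) \<partial>M)"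
      by simp
    also have "\<dots> \<le> (\<integral>\<omega>. f \<omega> powr p * (1 / (s powr p * p)) + g \<omega> powr q * (1 / (t powr q * q)) \<partial>M)"
    proof (rule integral_mono)
      show "integrable M (\<lambda>\<omega>. (f \<omega> / s) * (g \<omega> / t))"
        using int by simp
      show "integrable M (\<lambda>\<omega>. f \<omega> powr p * (1 / (s powr p * p)) + g \<omega> powr q * (1 / (t powr q * q)))"
        using f(3) g(3) by (intro Bochner_Integration.integrable_add integrable_mult_left)
      show "(f \<omega> / s) * (g \<omega> / t) \<le> f \<omega> powr p * (1 / (s powr p * p)) + g \<omega> powr q * (1 / (t powr q * q))" for \<omega>
        using Youngs_inequality[OF p q pq, of "f \<omega> / s" "g \<omega> / t"] f(2)[of \<omega>] g(2)[of \<omega>] st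
        by (simp add: powr_divide)
    qed
    also have "\<dots> = a powr p * (1 / (s powr p * p)) + b powr q * (1 / (t powr q * q))"
      unfolding powers using f(3) g(3) by (subst Bochner_Integration.integral_add) auto
    also have "\<dots> \<le> s powr p * (1 / (s powr p * p)) + t powr q * (1 / (t powr q * q))"
      using st ab p q by (intro add_mono mult_right_mono powr_mono2) auto
    also have "\<dots> = 1"
      using st pq by simp
    finally show ?thesis
      using st by (simp add: s_def[symmetric] t_def[symmetric])
  qed
  have "((\<lambda>e. (a + e) * (b + e)) \<longlongrightarrow> (a + 0) * (b + 0)) (at_right 0)"
    by (intro tendsto_intros)
  moreover have "eventually (\<lambda>e. (\<integral>\<omega>. f \<omega> * g \<omega> \<partial>M) \<le> (a + e) * (b + e)) (at_right 0)"
    using shifted by (auto simp: eventually_at_filter)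
  ultimately have "(\<integral>\<omega>. f \<omega> * g \<omega> \<partial>M) \<le> (a + 0) * (b + 0)"
    by (intro tendsto_lowerbound[of _ _ "at_right (0::real)"]) auto
  then show "(\<integral>\<omega>. f \<omega> * g \<omega> \<partial>M) \<le>
      (\<integral>\<omega>. f \<omega> powr p \<partial>M) powr (1 / p) * (\<integral>\<omega>. g \<omega> powr q \<partial>M) powr (1 / q)"
    by (simp add: a_def b_def)
qed


section \<open>Subgradients of a uniformly convex functional\<close>

text \<open>
  Think of \<open>N\<close> as the \<open>p\<close>-th power of a norm and of \<open>g v\<close> as the derivative of \<open>N / p\<close> at \<open>v\<close>. A
  minimiser \<open>v\<close> of \<open>E = N / p - f\<close> satisfies \<open>g v = f\<close>. Along a minimising sequence the midpoint gap
  of \<open>N\<close> tends to \<open>0\<close>, because \<open>E\<close> is at least its infimum at the midpoints; uniform convexity and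
  coercivity then make the sequence Cauchy.
  
  The subgradient inequality does double duty. At the limit point it gives the semicontinuity of \<open>N\<close>
  that shows the limit to be a minimiser. At the points \<open>v + t x\<close> near the minimiser it bounds the
  difference quotients of \<open>N\<close> from above, and continuity of \<open>g\<close> along lines yields the Euler equation.
\<close>

lemma subgradient_map_onto:
  fixes N :: "'x::banach \<Rightarrow> real" and g :: "'x \<Rightarrow> 'x \<Rightarrow> real"
  assumes p: "1 < p" and A: "0 < A"
    and coercive: "\<And>x. A * norm x powr p \<le> N x"
    and lin: "\<And>v. bounded_linear (g v)"
    and subgradient: "\<And>u v. N v + p * g v (u - v) \<le> N u"
    and hemicontinuous: "\<And>v x. (\<lambda>n. g (v + (1 / real (Suc n)) *\<^sub>R x) x) \<longlonglongrightarrow> g v x"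
    and convex: "\<And>\<epsilon>. 0 < \<epsilon> \<Longrightarrow>
       \<exists>C>0. \<forall>x y. N (x - y) \<le> \<epsilon> * (N x + N y) + C * ((N x + N y) / 2 - N ((1 / 2) *\<^sub>R (x + y)))"
    and f: "bounded_linear f"
  shows "\<exists>v. g v = f"
proof -
  interpret f: bounded_linear f by (rule f)
  define E where "E x = N x / p - f x" for x
  have N0: "0 \<le> N x" for x
    using coercive[of x] A by (smt (verit) mult_nonneg_nonneg powr_ge_zero)
  obtain c where c: "\<And>x. f x \<le> N x / (2 * p) + c"
  proof -
    obtain K where K: "0 < K" "\<And>x. norm (f x) \<le> norm x * K"
      using f.pos_bounded by blast
    define q where "q = p / (p - 1)"
    have q: "1 < q" "1 / p + 1 / q = 1"
      using p by (auto simp: q_def field_simps)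
    \<comment> \<open>Young's inequality for \<open>l * norm x\<close> and \<open>K / l\<close>; this \<open>l\<close> makes \<open>f\<close> cost only half of \<open>N / p\<close>.\<close>
    define l where "l = (A / 2) powr (1 / p)"
    have l: "0 < l" "l powr p = A / 2"
      using A p by (auto simp: l_def powr_powr)
    show ?thesis
    proof (rule that[of "(K / l) powr q / q"])
      fix x
      have "f x \<le> (l * norm x) * (K / l)"
        using K(2)[of x] l by (simp add: mult.commute)
      also have "\<dots> \<le> (l * norm x) powr p / p + (K / l) powr q / q"
        using p q l K by (intro Youngs_inequality) auto
      also have "(l * norm x) powr p / p = A * norm x powr p / (2 * p)"
        using l(1) by (simp add: powr_mult l(2))
      also have "\<dots> \<le> N x / (2 * p)"
        using coercive[of x] p by (intro divide_right_mono) auto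
      finally show "f x \<le> N x / (2 * p) + (K / l) powr q / q"
        by simp
    qed
  qed
  have E_lower: "N x / (2 * p) - c \<le> E x" for x
  proof -
    have "N x / p = N x / (2 * p) + N x / (2 * p)"
      using p by (simp add: field_simps)
    then show ?thesis
      using c[of x] by (simp add: E_def)
  qed
  define m where "m = Inf (range E)"
  have "- c \<le> E x" for x
    using E_lower[of x] N0[of x] p by (smt (verit) divide_nonneg_nonneg)
  then have bdd: "bdd_below (range E)"
    by (intro bdd_belowI[of _ "- c"]) auto
  have m_le: "m \<le> E x" for x
    unfolding m_def using bdd by (rule cInf_lower[rotated]) auto
  have "\<exists>x. E x < m + 1 / real (Suc n)" for n
    using cInf_lessD[of "range E" "m + 1 / real (Suc n)"] by (auto simp: m_def)
  then obtain X where X: "\<And>n. E (X n) < m + 1 / real (Suc n)"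
    by metis
  define R where "R = 2 * p * (m + 1 + c)"
  have N_le: "N (X n) \<le> R" for n
  proof -
    have "1 / real (Suc n) \<le> 1"
      by simp
    then have "N (X n) / (2 * p) \<le> m + 1 + c"
      using E_lower[of "X n"] X[of n] by linarith
    then show ?thesis
      using p by (simp add: R_def field_simps)
  qed
  have defect: "(N x + N y) / 2 - N ((1 / 2) *\<^sub>R (x + y)) \<le> p * ((E x + E y) / 2 - m)" for x y
  proof -
    have "(N x + N y) / 2 - N ((1 / 2) *\<^sub>R (x + y)) =
        p * ((E x + E y) / 2 - E ((1 / 2) *\<^sub>R (x + y)))"
      using p by (simp add: E_def f.scaleR f.add field_simps)
    also have "\<dots> \<le> p * ((E x + E y) / 2 - m)"
      using p m_le by (intro mult_left_mono) auto
    finally show ?thesis .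
  qed
  have "Cauchy X"
  proof (rule metric_CauchyI)
    fix e :: real
    assume e: "0 < e"
    define a where "a = A * e powr p"
    have a: "0 < a"
      using A e by (simp add: a_def)
    have R0: "0 \<le> R"
      using N_le[of 0] N0[of "X 0"] by linarith
    \<comment> \<open>The weight for which the term \<open>\<epsilon> * (N x + N y)\<close>, with both energies at most \<open>R\<close>, stays below \<open>a / 2\<close>.\<close>
    define \<epsilon> where "\<epsilon> = a / (4 * R + 4)"
    have \<epsilon>: "0 < \<epsilon>" "\<epsilon> * (2 * R) < a / 2"
      using a R0 by (auto simp: \<epsilon>_def field_simps add_nonneg_pos)
    obtain C where C: "0 < C"
      "\<And>x y. N (x - y) \<le> \<epsilon> * (N x + N y) + C * ((N x + N y) / 2 - N ((1 / 2) *\<^sub>R (x + y)))"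
      using convex[OF \<epsilon>(1)] by blast
    obtain k :: nat where k: "2 * C * p / a < real k"
      using reals_Archimedean2 by blast
    have kC: "C * (p * (1 / real (Suc k))) < a / 2"
    proof -
      have "2 * C * p / a < real (Suc k)"
        using k by simp
      then show ?thesis
        using a by (simp add: field_simps)
    qed
    have "dist (X i) (X j) < e" if "k \<le> i" "k \<le> j" for i j
    proof -
      have "1 / real (Suc i) \<le> 1 / real (Suc k)" "1 / real (Suc j) \<le> 1 / real (Suc k)"
        using that by (auto intro: divide_left_mono)
      then have "(E (X i) + E (X j)) / 2 - m \<le> 1 / real (Suc k)"
        using X[of i] X[of j] by argo
      then have "p * ((E (X i) + E (X j)) / 2 - m) \<le> p * (1 / real (Suc k))"
        using p by (intro mult_left_mono) auto
      then have "(N (X i) + N (X j)) / 2 - N ((1 / 2) *\<^sub>R (X i + X j)) \<le> p * (1 / real (Suc k))"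
        using defect order_trans by blast
      then have "C * ((N (X i) + N (X j)) / 2 - N ((1 / 2) *\<^sub>R (X i + X j))) \<le> C * (p * (1 / real (Suc k)))"
        using C(1) by (intro mult_left_mono) auto
      moreover have "\<epsilon> * (N (X i) + N (X j)) \<le> \<epsilon> * (2 * R)"
        using \<epsilon>(1) N_le[of i] N_le[of j] by (intro mult_left_mono) auto
      ultimately have "N (X i - X j) < a"
        using C(2)[of "X i" "X j"] kC \<epsilon>(2) by argo
      then have "A * norm (X i - X j) powr p < A * e powr p"
        using coercive[of "X i - X j"] by (simp add: a_def)
      then have lt: "norm (X i - X j) powr p < e powr p"
        using A by simp
      have "norm (X i - X j) < e"
      proof (rule ccontr)
        assume "\<not> norm (X i - X j) < e"
        then have "e powr p \<le> norm (X i - X j) powr p"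
          using e p by (intro powr_mono2) auto
        then show False
          using lt by simp
      qed
      then show ?thesis
        by (simp add: dist_norm)
    qed
    then show "\<exists>M. \<forall>i\<ge>M. \<forall>j\<ge>M. dist (X i) (X j) < e"
      by blast
  qed
  then obtain v where v: "X \<longlonglongrightarrow> v"
    using Cauchy_convergent convergent_def by blast
  have "E v \<le> m"
  proof -
    interpret g: bounded_linear "g v" by (rule lin)
    have "(\<lambda>n. m + 1 / real (Suc n) + (f (X n - v) - g v (X n - v))) \<longlonglongrightarrow>
        m + 0 + (f (v - v) - g v (v - v))"
      using LIMSEQ_Suc[OF lim_1_over_n[where 'a = real]]
      by (intro tendsto_intros v f.tendsto g.tendsto)
    then have lim: "(\<lambda>n. m + 1 / real (Suc n) + (f (X n - v) - g v (X n - v))) \<longlonglongrightarrow> m"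
      by (simp add: f.zero g.zero)
    have "E v \<le> m + 1 / real (Suc n) + (f (X n - v) - g v (X n - v))" for n
    proof -
      have "(N v + p * g v (X n - v)) / p \<le> N (X n) / p"
        using subgradient[of v "X n"] p by (intro divide_right_mono) auto
      then have "N v / p + g v (X n - v) \<le> N (X n) / p"
        using p by (simp add: add_divide_distrib)
      then show ?thesis
        using X[of n] by (simp add: E_def f.diff)
    qed
    then show ?thesis
      using lim by (intro LIMSEQ_le_const) auto
  qed
  then have E_min: "E v \<le> E x" for x
    using m_le order_trans by blast
  have le: "f x \<le> g v x" for x
  proof -
    have "f x \<le> g (v + (1 / real (Suc n)) *\<^sub>R x) x" for n
    proof -
      define t where "t = 1 / real (Suc n)"
      have t: "0 < t"
        by (simp add: t_def)
      interpret g: bounded_linear "g (v + t *\<^sub>R x)" by (rule lin)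
      have "N v / p \<le> N (v + t *\<^sub>R x) / p - t * f x"
        using E_min[of "v + t *\<^sub>R x"] by (simp add: E_def f.add f.scaleR)
      then have "p * (N v / p) \<le> p * (N (v + t *\<^sub>R x) / p - t * f x)"
        using p by (intro mult_left_mono) auto
      then have "N v \<le> N (v + t *\<^sub>R x) - p * (t * f x)"
        using p by (simp add: right_diff_distrib)
      moreover have "N (v + t *\<^sub>R x) - p * (t * g (v + t *\<^sub>R x) x) \<le> N v"
        using subgradient[of "v + t *\<^sub>R x" v] by (simp add: g.neg g.scaleR)
      ultimately have "p * (t * f x) \<le> p * (t * g (v + t *\<^sub>R x) x)"
        by linarith
      then have "f x \<le> g (v + t *\<^sub>R x) x"
        using p t by simp
      then show ?thesis
        by (simp only: t_def)
    qed
    then show ?thesis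
      using hemicontinuous[of v x] by (intro LIMSEQ_le_const) auto
  qed
  interpret g: bounded_linear "g v" by (rule lin)
  have "g v x = f x" for x
    using le[of x] le[of "- x"] by (simp add: g.neg f.neg)
  then show ?thesis
    by blast
qed


section \<open>Norming functionals and weakly bounded sets\<close>

text \<open>
  Homogeneity is asked for only as an inequality and for positive factors, which is easier to
  establish and implies the equation.
\<close>

definition sublinear :: "('a::real_vector \<Rightarrow> real) \<Rightarrow> bool" where
  "sublinear q \<longleftrightarrow> (\<forall>x y. q (x + y) \<le> q x + q y) \<and> (\<forall>t>0. \<forall>x. q (t *\<^sub>R x) \<le> t * q x)"

lemma sublinear_add: "sublinear q \<Longrightarrow> q (x + y) \<le> q x + q y"
  by (simp add: sublinear_def)

lemma sublinear_scale:
  assumes "sublinear q" "0 < t"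
  shows "q (t *\<^sub>R x) = t * q x"
proof (rule antisym)
  show "q (t *\<^sub>R x) \<le> t * q x"
    using assms by (simp add: sublinear_def)
  have "q (inverse t *\<^sub>R (t *\<^sub>R x)) \<le> inverse t * q (t *\<^sub>R x)"
    using assms unfolding sublinear_def by (meson positive_imp_inverse_positive)
  then show "t * q x \<le> q (t *\<^sub>R x)"
    using assms(2) by (simp add: field_simps)
qed

lemma sublinear_zero:
  assumes "sublinear q"
  shows "q 0 = 0"
  using sublinear_scale[OF assms, of 2 0] by simp

lemma sublinear_lower_bound:
  assumes "sublinear q"
  shows "- q (- x) \<le> q x"
  using sublinear_add[OF assms, of x "- x"] sublinear_zero[OF assms] by simp

text \<open>
  The largest sublinear functional below \<open>q\<close> that takes the value \<open>- q y\<close> at \<open>- y\<close>, that is, the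
  largest one that is linear with value \<open>q y\<close> in the direction \<open>y\<close>.
\<close>

definition tilt :: "('a::real_vector \<Rightarrow> real) \<Rightarrow> 'a \<Rightarrow> 'a \<Rightarrow> real" where
  "tilt q y x = (INF t\<in>{0..}. q (x + t *\<^sub>R y) - t * q y)"

lemma tilt_le:
  assumes q: "sublinear q" and "0 \<le> t"
  shows "tilt q y x \<le> q (x + t *\<^sub>R y) - t * q y"
  unfolding tilt_def
proof (rule cINF_lower)
  have "- q (- x) \<le> q (x + s *\<^sub>R y) - s * q y" if "0 \<le> s" for s
  proof -
    have "q (s *\<^sub>R y) = s * q y"
      using that sublinear_scale[OF q, of s y] sublinear_zero[OF q] by (cases "s = 0") auto
    then show ?thesis
      using sublinear_add[OF q, of "x + s *\<^sub>R y" "- x"] by simp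
  qed
  then show "bdd_below ((\<lambda>t. q (x + t *\<^sub>R y) - t * q y) ` {0..})"
    by (intro bdd_belowI[of _ "- q (- x)"]) auto
qed (use assms in auto)

lemma tilt_greatest:
  assumes "\<And>t. 0 \<le> t \<Longrightarrow> c \<le> q (x + t *\<^sub>R y) - t * q y"
  shows "c \<le> tilt q y x"
  unfolding tilt_def by (rule cINF_greatest) (use assms in auto)

lemma tilt_le_self: "sublinear q \<Longrightarrow> tilt q y x \<le> q x"
  using tilt_le[of q 0 y x] by simp

lemma sublinear_tilt:
  assumes q: "sublinear q"
  shows "sublinear (tilt q y)"
  unfolding sublinear_def
proof (intro conjI allI impI)
  fix u v
  have "tilt q y (u + v) - (q (u + s *\<^sub>R y) - s * q y) \<le> q (v + t *\<^sub>R y) - t * q y"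
    if "0 \<le> s" "0 \<le> t" for s t
  proof -
    have "tilt q y (u + v) \<le> q (u + v + (s + t) *\<^sub>R y) - (s + t) * q y"
      using that by (intro tilt_le q) auto
    also have "u + v + (s + t) *\<^sub>R y = (u + s *\<^sub>R y) + (v + t *\<^sub>R y)"
      by (simp add: algebra_simps)
    finally show ?thesis
      using sublinear_add[OF q, of "u + s *\<^sub>R y" "v + t *\<^sub>R y"] by (simp add: algebra_simps)
  qed
  then have "tilt q y (u + v) - (q (u + s *\<^sub>R y) - s * q y) \<le> tilt q y v" if "0 \<le> s" for s
    using that by (intro tilt_greatest) auto
  then have "tilt q y (u + v) - tilt q y v \<le> q (u + s *\<^sub>R y) - s * q y" if "0 \<le> s" for s
    using that by (smt (verit))
  then have "tilt q y (u + v) - tilt q y v \<le> tilt q y u"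
    by (intro tilt_greatest) auto
  then show "tilt q y (u + v) \<le> tilt q y u + tilt q y v"
    by simp
next
  fix c :: real and u
  assume c: "0 < c"
  have "tilt q y (c *\<^sub>R u) / c \<le> q (u + t *\<^sub>R y) - t * q y" if "0 \<le> t" for t
  proof -
    have "tilt q y (c *\<^sub>R u) \<le> q (c *\<^sub>R u + (c * t) *\<^sub>R y) - (c * t) * q y"
      using that c by (intro tilt_le q) auto
    also have "c *\<^sub>R u + (c * t) *\<^sub>R y = c *\<^sub>R (u + t *\<^sub>R y)"
      by (simp add: algebra_simps)
    also have "q (c *\<^sub>R (u + t *\<^sub>R y)) = c * q (u + t *\<^sub>R y)"
      by (rule sublinear_scale[OF q c])
    finally show ?thesis
      using c by (simp add: field_simps)
  qed
  then have "tilt q y (c *\<^sub>R u) / c \<le> tilt q y u"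
    by (rule tilt_greatest)
  then show "tilt q y (c *\<^sub>R u) \<le> c * tilt q y u"
    using c by (simp add: field_simps)
qed

text \<open>
  Zorn's lemma. The pointwise infimum of a chain is finite because every sublinear functional
  \<open>q \<le> p\<close> satisfies \<open>- p (- x) \<le> q x\<close>.
\<close>

lemma minimal_sublinear_exists:
  fixes p :: "'a::real_vector \<Rightarrow> real"
  assumes p: "sublinear p"
  obtains q where "sublinear q" "q \<le> p" "\<And>r. sublinear r \<Longrightarrow> r \<le> q \<Longrightarrow> r = q"
proof -
  define S where "S = {q. sublinear q \<and> q \<le> p}"
  have "\<exists>m\<in>S. \<forall>a\<in>S. a \<le> m \<longrightarrow> a = m"
  proof (rule predicate_Zorn)
    show "partial_order_on S (relation_of (\<lambda>a b. b \<le> a) S)"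
      by (rule partial_order_on_relation_ofI) auto
  next
    fix C
    assume C: "C \<in> Chains (relation_of (\<lambda>a b. b \<le> a) S)"
    then have CS: "C \<subseteq> S" and total: "a \<le> b \<or> b \<le> a" if "a \<in> C" "b \<in> C" for a b
      using that unfolding Chains_def relation_of_def by blast+
    have CS: "sublinear q \<and> q \<le> p" if "q \<in> C" for q
      using C that unfolding Chains_def relation_of_def S_def by blast
    show "\<exists>u\<in>S. \<forall>a\<in>C. u \<le> a"
    proof (cases "C = {}")
      case True
      then show ?thesis
        using p by (auto simp: S_def)
    next
      case False
      define u where "u x = (INF q\<in>C. q x)" for x
      have bdd: "bdd_below ((\<lambda>q. q x) ` C)" for x
      proof (rule bdd_belowI)
        fix r assume "r \<in> (\<lambda>q. q x) ` C"
        then obtain q where "q \<in> C" "r = q x" by blast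
        then show "- p (- x) \<le> r"
          using CS[of q] sublinear_lower_bound[of q x] unfolding le_fun_def by (smt (verit))
      qed
      have u_le: "u x \<le> q x" if "q \<in> C" for q x
        unfolding u_def using that bdd by (rule cINF_lower[rotated])
      have u_ge: "c \<le> u x" if "\<And>q. q \<in> C \<Longrightarrow> c \<le> q x" for c x
        unfolding u_def using that False by (intro cINF_greatest) auto
      have "sublinear u"
        unfolding sublinear_def
      proof (intro conjI allI impI)
        fix x y
        have "u (x + y) \<le> q x + r y" if "q \<in> C" "r \<in> C" for q r
        proof -
          have "u (x + y) \<le> q x + q y" "u (x + y) \<le> r x + r y"
            using that CS u_le sublinear_add order_trans by metis+
          then show ?thesis
            using total[OF that] unfolding le_fun_def by (smt (verit))
        qed
        then have "u (x + y) - r y \<le> q x" if "q \<in> C" "r \<in> C" for q r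
          using that by (simp add: algebra_simps)
        then have "u (x + y) - r y \<le> u x" if "r \<in> C" for r
          using that by (intro u_ge)
        then have "u (x + y) - u x \<le> r y" if "r \<in> C" for r
          using that by (simp add: algebra_simps)
        then have "u (x + y) - u x \<le> u y"
          by (rule u_ge)
        then show "u (x + y) \<le> u x + u y"
          by simp
      next
        fix t :: real and x
        assume t: "0 < t"
        have "u (t *\<^sub>R x) / t \<le> q x" if "q \<in> C" for q
          using u_le[OF that, of "t *\<^sub>R x"] CS[OF that] sublinear_scale[of q t x] t
          by (simp add: field_simps)
        then have "u (t *\<^sub>R x) / t \<le> u x"
          by (rule u_ge)
        then show "u (t *\<^sub>R x) \<le> t * u x"
          using t by (simp add: field_simps)
      qed
      moreover have "u \<le> p"
      proof -
        obtain q where "q \<in> C"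
          using False by blast
        then show ?thesis
          using u_le[of q] CS[of q] unfolding le_fun_def by (meson order_trans)
      qed
      ultimately show ?thesis
        using u_le by (auto simp: S_def le_fun_def)
    qed
  qed
  then obtain q where "q \<in> S" "\<And>r. r \<in> S \<Longrightarrow> r \<le> q \<Longrightarrow> r = q"
    by blast
  with that show ?thesis
    unfolding S_def by (metis (no_types, lifting) mem_Collect_eq order_trans)
qed

text \<open>
  The Hahn-Banach theorem: a minimal sublinear functional is
  linear, since it coincides with its tilt in every direction.
\<close>

lemma linear_below_sublinear:
  fixes p :: "'a::real_vector \<Rightarrow> real"
  assumes "sublinear p"
  obtains f where "linear f" "\<And>x. f x \<le> p x"
proof -
  obtain q where q: "sublinear q" "q \<le> p" and min: "\<And>r. sublinear r \<Longrightarrow> r \<le> q \<Longrightarrow> r = q"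
    using minimal_sublinear_exists[OF assms] by blast
  have "tilt q y = q" for y
    using tilt_le_self[OF q(1)] by (intro min sublinear_tilt q) (auto simp: le_fun_def)
  then have "q x + q y \<le> q (x + y)" for x y
    using tilt_le[OF q(1), of 1 y x] by simp
  then have add: "q (x + y) = q x + q y" for x y
    using sublinear_add[OF q(1), of x y] by (simp add: antisym)
  have neg: "q (- x) = - q x" for x
    using add[of x "- x"] sublinear_zero[OF q(1)] by simp
  have "q (c *\<^sub>R x) = c *\<^sub>R q x" for c x
  proof (cases c "0::real" rule: linorder_cases)
    case less
    then show ?thesis
      using sublinear_scale[OF q(1), of "- c" x] neg[of "c *\<^sub>R x"] by simp
  qed (use sublinear_scale[OF q(1)] sublinear_zero[OF q(1)] in auto)
  then have "linear q"
    using add by (intro linearI)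
  then show ?thesis
    using that q(2) by (auto simp: le_fun_def)
qed

text \<open>
  A linear functional below the tilt of the norm in the direction \<open>x0\<close> has value at most
  \<open>- norm x0\<close> at \<open>- x0\<close>, so it attains its norm at \<open>x0\<close>.
\<close>

lemma norming_functional:
  fixes x0 :: "'a::real_normed_vector"
  obtains f :: "'a \<Rightarrow> real" where "bounded_linear f" "f x0 = norm x0" "\<And>x. \<bar>f x\<bar> \<le> norm x"
proof -
  have norm: "sublinear (norm :: 'a \<Rightarrow> real)"
    by (auto simp: sublinear_def norm_triangle_ineq)
  obtain f where f: "linear f" "\<And>x. f x \<le> tilt norm x0 x"
    using linear_below_sublinear[OF sublinear_tilt[OF norm]] by blast
  have le: "f x \<le> norm x" for x
    using f(2)[of x] tilt_le_self[OF norm, of x0 x] by simp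
  have abs_le: "\<bar>f x\<bar> \<le> norm x" for x
    using le[of x] le[of "- x"] linear_neg[OF f(1), of x] by simp
  have "f (- x0) \<le> - norm x0"
    using f(2)[of "- x0"] tilt_le[OF norm, of 1 x0 "- x0"] by simp
  then have "f x0 = norm x0"
    using linear_neg[OF f(1), of x0] le[of x0] by simp
  moreover have "bounded_linear f"
    using f(1) abs_le by (intro bounded_linear_intro[where K = 1])
      (auto simp: linear_add linear_scale)
  ultimately show ?thesis
    using that abs_le by blast
qed

text \<open>
  The uniform boundedness principle on the dual space: by Baire's theorem the points of \<open>S\<close> are
  uniformly bounded on some ball of functionals, hence on the unit ball, and norming functionals turn
  this into a bound for the norms.
\<close>

lemma weakly_bounded_imp_bounded:
  fixes S :: "'a::real_normed_vector set"
  assumes weak: "\<And>f :: 'a \<Rightarrow> real. bounded_linear f \<Longrightarrow> \<exists>C. \<forall>x\<in>S. \<bar>f x\<bar> \<le> C"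
  obtains R where "0 < R" "\<And>x. x \<in> S \<Longrightarrow> norm x \<le> R"
proof -
  define E where "E n = {f :: 'a \<Rightarrow>\<^sub>L real. \<forall>x\<in>S. \<bar>blinfun_apply f x\<bar> \<le> real n}" for n
  have closed: "closed (E n)" for n
  proof -
    have "E n = (\<Inter>x\<in>S. {f. \<bar>blinfun_apply f x\<bar> \<le> real n})"
      by (auto simp: E_def)
    also have "closed \<dots>"
      by (intro closed_INT ballI closed_Collect_le continuous_intros)
    finally show ?thesis .
  qed
  have cover: "(\<Union>n. E n) = UNIV"
  proof -
    have "\<exists>n. f \<in> E n" for f
    proof -
      obtain C where C: "\<forall>x\<in>S. \<bar>blinfun_apply f x\<bar> \<le> C"
        using weak[OF blinfun.bounded_linear_right] by blast
      obtain n :: nat where "C \<le> real n"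
        using real_arch_simple by blast
      with C show ?thesis
        unfolding E_def by (intro exI[of _ n]) (auto intro: order_trans)
    qed
    then show ?thesis
      by blast
  qed
  have "\<exists>n. interior (E n) \<noteq> {}"
  proof (rule ccontr)
    assume "\<not> (\<exists>n. interior (E n) \<noteq> {})"
    then have "euclidean interior_of \<Union>(range E) = {}"
      using closed completely_metrizable_space_euclidean by (intro Baire_category_alt) auto
    then show False
      using cover by simp
  qed
  then obtain n where "interior (E n) \<noteq> {}"
    by blast
  then obtain f r where r: "0 < r" "cball f r \<subseteq> E n"
    by (metis ex_in_conv mem_interior_cball)
  have "norm x \<le> 2 * real n / r + 1" if "x \<in> S" for x
  proof -
    obtain g where g: "bounded_linear g" "g x = norm x" "\<And>y. \<bar>g y\<bar> \<le> norm y"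
      using norming_functional[of x] by blast
    define h where "h = Blinfun g"
    have h: "blinfun_apply h = g"
      using g(1) by (simp add: h_def bounded_linear_Blinfun_apply)
    have "norm h \<le> 1"
      using g(3) by (intro norm_blinfun_bound) (auto simp: h)
    then have "f + r *\<^sub>R h \<in> cball f r"
      using r(1) by (simp add: dist_norm)
    moreover have "f \<in> cball f r"
      using r(1) by simp
    ultimately have "f + r *\<^sub>R h \<in> E n" "f \<in> E n"
      using r(2) by blast+
    then have "\<bar>blinfun_apply f x + r * norm x\<bar> \<le> n" "\<bar>blinfun_apply f x\<bar> \<le> n"
      using that by (auto simp: E_def h g(2) blinfun.add_left blinfun.scaleR_left)
    then have "r * norm x \<le> 2 * real n"
      by linarith
    then show ?thesis
      using r(1) by (simp add: field_simps)
  qed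
  moreover have "0 < 2 * real n / r + 1"
    using r(1) by (simp add: add_nonneg_pos)
  ultimately show ?thesis
    using that by blast
qed


section \<open>Scalars and real parts of linear functionals\<close>

lemma cplx_zero [simp]: "cplx (0::'k::real_or_complex) = 0"
  using cplx_add[of "0::'k" 0] by simp

lemma cplx_one [simp]: "cplx (1::'k::real_or_complex) = 1"
proof -
  have "cplx (1::'k) * cplx (1::'k) = cplx (1::'k)"
    by (subst cplx_mult[symmetric]) simp
  moreover have "cplx (1::'k) \<noteq> 0"
    using norm_cplx[of "1::'k"] by auto
  ultimately show ?thesis
    by simp
qed

lemma cplx_of_real [simp]: "cplx (of_real r :: 'k::real_or_complex) = of_real r"
  using cplx_scaleR[of r "1::'k"] by (simp add: of_real_def)

lemma cplx_minus [simp]: "cplx (- a) = - cplx (a::'k::real_or_complex)"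
  using cplx_scaleR[of "-1" a] by simp

lemma cplx_diff: "cplx (a - b) = cplx a - cplx (b::'k::real_or_complex)"
  using cplx_add[of a "- b"] by simp

lemma cplx_eq_iff: "cplx a = cplx b \<longleftrightarrow> a = (b::'k::real_or_complex)"
proof
  assume eq: "cplx a = cplx b"
  have "cplx (a - b) = 0"
    using eq by (simp add: cplx_diff)
  then show "a = b"
    using norm_cplx[of "a - b"] by simp
qed simp

lemma bounded_linear_cplx: "bounded_linear (cplx :: 'k::real_or_complex \<Rightarrow> complex)"
  by (intro bounded_linear_intro[where K = 1]) (auto simp: cplx_add cplx_scaleR norm_cplx)

lemma bounded_linear_Re_cplx: "bounded_linear (\<lambda>a::'k::real_or_complex. Re (cplx a))"
  using bounded_linear_compose[OF bounded_linear_Re bounded_linear_cplx] .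

text \<open>
  Real parts suffice to identify scalars, provided that all multiples are compared; this passes from
  the real Euler equation of a minimisation problem to an identity of scalars.
\<close>

lemma scalar_eqI_Re:
  fixes a b :: "'k::real_or_complex"
  assumes "\<And>c. Re (cplx (c * a)) = Re (cplx (c * b))"
  shows "a = b"
proof (rule ccontr)
  assume "a \<noteq> b"
  then have "inverse (a - b) * (a - b) = 1"
    by simp
  then have "inverse (a - b) * a = inverse (a - b) * b + 1"
    by (simp add: algebra_simps)
  then show False
    using assms[of "inverse (a - b)"] by (simp add: cplx_add)
qed

lemma scalar_mult_of_real:
  fixes s :: "'k::real_or_complex \<Rightarrow> 'x::real_normed_vector \<Rightarrow> 'x"
  shows "scalar_mult s \<Longrightarrow> s (of_real r) x = r *\<^sub>R x"
  by (simp add: scalar_mult_def)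

text \<open>
  If the scalar field contains an imaginary unit \<open>j\<close>, then \<open>x \<mapsto> f x - j f (j x)\<close> is linear over it
  and has real part \<open>f\<close>. Otherwise all scalars are real and \<open>f\<close> itself will do.
\<close>

lemma real_functional_lift:
  fixes s :: "'k::real_or_complex \<Rightarrow> 'x::real_normed_vector \<Rightarrow> 'x" and f :: "'x \<Rightarrow> real"
  assumes s: "scalar_mult s" and f: "bounded_linear f"
  obtains \<phi> where "\<phi> \<in> dual_space s" "\<And>x. Re (cplx (\<phi> x)) = f x"
proof -
  interpret f: bounded_linear f by (rule f)
  interpret s: vector_space s
    using s by (simp add: scalar_mult_def)
  have real: "s (of_real r) x = r *\<^sub>R x" for r x
    using s by (rule scalar_mult_of_real)
  show ?thesis
  proof (cases "\<exists>j::'k. cplx j = \<i>")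
    case False
    have scalar_real: "c = of_real (Re (cplx c))" for c :: 'k
    proof -
      have "Im (cplx c) = 0"
      proof (rule ccontr)
        assume im: "Im (cplx c) \<noteq> 0"
        have "cplx ((1 / Im (cplx c)) *\<^sub>R (c - of_real (Re (cplx c)))) = \<i>"
          using im by (simp add: cplx_scaleR cplx_diff complex_eq_iff)
        then show False
          using False by blast
      qed
      then have "cplx c = cplx (of_real (Re (cplx c)))"
        by (simp add: complex_eq_iff)
      then show ?thesis
        using cplx_eq_iff by blast
    qed
    have hom: "of_real (f (s c x)) = c * (of_real (f x) :: 'k)" for c x
    proof -
      obtain r where "c = of_real r"
        using scalar_real by blast
      then show ?thesis
        by (simp add: real f.scaleR)
    qed
    have "bounded_linear (\<lambda>x. of_real (f x) :: 'k)"
      using bounded_linear_compose[OF bounded_linear_of_real f] .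
    then have "(\<lambda>x. of_real (f x) :: 'k) \<in> dual_space s"
      using hom by (auto simp: bounded_operators_def)
    then show ?thesis
      using that by force
  next
    case True
    then obtain j :: 'k where j: "cplx j = \<i>"
      by blast
    have jj: "j * j = -1"
      by (rule iffD1[OF cplx_eq_iff]) (simp add: cplx_mult j)
    have scalar: "c = of_real (Re (cplx c)) + of_real (Im (cplx c)) * j" for c :: 'k
      by (rule iffD1[OF cplx_eq_iff]) (simp add: cplx_add cplx_mult j complex_eq_iff)
    define \<phi> where "\<phi> x = of_real (f x) - j * of_real (f (s j x))" for x
    have norm_j: "norm (s j x) = norm x" for x
      using s norm_cplx[of j] j by (simp add: scalar_mult_def)
    have sj: "bounded_linear (s j)"
    proof (rule bounded_linear_intro[where K = 1])
      show "s j (r *\<^sub>R x) = r *\<^sub>R s j x" for r x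
        using s.scale_left_commute[of j "of_real r" x] by (simp only: real)
    qed (auto simp: s.scale_right_distrib norm_j)
    have lin: "bounded_linear \<phi>"
      unfolding \<phi>_def
      by (intro bounded_linear_sub bounded_linear_compose[OF bounded_linear_of_real]
          bounded_linear_compose[OF bounded_linear_mult_right] bounded_linear_compose[OF f sj] f)
    interpret \<phi>: bounded_linear \<phi> by (rule lin)
    have \<phi>_j: "\<phi> (s j x) = j * \<phi> x" for x
    proof -
      have "s j (s j x) = - x"
        by (simp add: jj)
      then have "\<phi> (s j x) = of_real (f (s j x)) + j * of_real (f x)"
        by (simp add: \<phi>_def f.neg)
      also have "\<dots> = j * \<phi> x"
        using jj by (simp add: \<phi>_def right_diff_distrib mult.assoc[symmetric])
      finally show ?thesis .
    qed
    have hom: "\<phi> (s c x) = c * \<phi> x" for c x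
    proof -
      define a b where "a = Re (cplx c)" and "b = Im (cplx c)"
      have c: "c = of_real a + of_real b * j"
        using scalar[of c] by (simp add: a_def b_def)
      have "s c x = a *\<^sub>R x + b *\<^sub>R s j x"
        unfolding c s.scale_left_distrib s.scale_scale[symmetric] real ..
      then have "\<phi> (s c x) = a *\<^sub>R \<phi> x + b *\<^sub>R (j * \<phi> x)"
        by (simp add: \<phi>.add \<phi>.scaleR \<phi>_j)
      also have "\<dots> = c * \<phi> x"
        unfolding c by (simp add: scaleR_conv_of_real algebra_simps)
      finally show ?thesis .
    qed
    have "\<phi> \<in> dual_space s"
      using lin hom by (auto simp: bounded_operators_def)
    moreover have "Re (cplx (\<phi> x)) = f x" for x
      by (simp add: \<phi>_def cplx_diff cplx_mult j)
    ultimately show ?thesis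
      using that by blast
  qed
qed


section \<open>The pairing of a Hilbert space with itself\<close>

locale hilbert_pairing =
  fixes sK :: "'k::real_or_complex \<Rightarrow> 'h::banach \<Rightarrow> 'h"
    and ip :: "'h \<Rightarrow> 'h \<Rightarrow> 'k"
    and \<nu> :: "'h \<Rightarrow> 'h \<Rightarrow> 'k"
  assumes sK: "scalar_mult sK" and ip: "inner_product sK ip" and \<nu>: "isometric_iso_to_dual sK \<nu>"
begin

lemma sK_of_real: "sK (of_real r) x = r *\<^sub>R x"
  using sK by (rule scalar_mult_of_real)

lemma norm_sK: "norm (sK c x) = norm c * norm x"
  using sK by (simp add: scalar_mult_def)

lemma ip_add_left: "ip (u + v) w = ip u w + ip v w"
  and ip_sK_left: "ip (sK c u) v = c * ip u v"
  and ip_conjugate: "cplx (ip v u) = cnj (cplx (ip u v))"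
  and ip_self: "ip u u = of_real ((norm u)\<^sup>2)"
  using ip unfolding inner_product_def by blast+

lemma ip_scaleR_left: "ip (r *\<^sub>R u) v = r *\<^sub>R ip u v"
  using ip_sK_left[of "of_real r"] by (simp add: sK_of_real scaleR_conv_of_real)

lemma ip_add_right: "ip u (v + w) = ip u v + ip u w"
proof -
  have "cplx (ip u (v + w)) = cplx (ip u v + ip u w)"
    unfolding cplx_add ip_conjugate[of u "v + w"] ip_conjugate[of u v] ip_conjugate[of u w]
      ip_add_left by simp
  then show ?thesis
    by (simp only: cplx_eq_iff)
qed

definition rip :: "'h \<Rightarrow> 'h \<Rightarrow> real" where
  "rip u v = Re (cplx (ip u v))"

lemma rip_add_left: "rip (u + v) w = rip u w + rip v w"
  by (simp add: rip_def ip_add_left cplx_add)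

lemma rip_commute: "rip u v = rip v u"
  by (simp add: rip_def ip_conjugate[of u v])

lemma rip_scaleR_left: "rip (r *\<^sub>R u) v = r * rip u v"
  by (simp add: rip_def ip_scaleR_left cplx_scaleR)

lemma rip_self: "rip u u = (norm u)\<^sup>2"
  by (simp add: rip_def ip_self del: of_real_power)

lemma norm_add_squared: "(norm (u + v))\<^sup>2 = (norm u)\<^sup>2 + 2 * rip u v + (norm v)\<^sup>2"
proof -
  have "rip (u + v) (u + v) = rip u u + 2 * rip u v + rip v v"
    using rip_add_left[of u v "u + v"] rip_add_left[of u v u] rip_add_left[of u v v]
      rip_commute[of u "u + v"] rip_commute[of v "u + v"] rip_commute[of u v] by linarith
  then show ?thesis
    by (simp add: rip_self)
qed

lemma rip_le: "rip u v \<le> norm u * norm v"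
proof -
  have "(norm (u + v))\<^sup>2 \<le> (norm u + norm v)\<^sup>2"
    by (intro power_mono norm_triangle_ineq) auto
  then show ?thesis
    unfolding norm_add_squared by (simp add: power2_sum)
qed

text \<open>
  Multiplying \<open>u\<close> by a scalar of modulus \<open>1\<close> makes the inner product real and nonnegative.
\<close>

lemma norm_ip_le: "norm (ip u v) \<le> norm u * norm v"
proof (cases "ip u v = 0")
  case False
  define c where "c = inverse (ip u v) * of_real (norm (ip u v))"
  have "c * ip u v = of_real (norm (ip u v))"
    using False by (simp add: c_def)
  then have "norm (ip u v) = rip (sK c u) v"
    by (simp add: rip_def ip_sK_left)
  also have "\<dots> \<le> norm (sK c u) * norm v"
    by (rule rip_le)
  also have "norm (sK c u) = norm u"
    using False by (simp add: norm_sK c_def norm_mult norm_inverse)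
  finally show ?thesis .
qed auto

lemma parallelogram:
  fixes u v :: 'h
  shows "(norm (u + v))\<^sup>2 + (norm (u - v))\<^sup>2 = 2 * (norm u)\<^sup>2 + 2 * (norm v)\<^sup>2"
proof -
  have "rip u (- v) = - rip u v"
    using rip_scaleR_left[of "-1" v u] by (simp add: rip_commute)
  then show ?thesis
    using norm_add_squared[of u v] norm_add_squared[of u "- v"] by simp
qed

lemma bounded_linear_ip: "bounded_linear (\<lambda>u. ip u v)"
  by (intro bounded_linear_intro[where K = "norm v"]) (auto simp: ip_add_left ip_scaleR_left norm_ip_le)

lemma onorm_ip: "onorm (\<lambda>u. ip u v) = norm v"
proof (rule antisym)
  show "onorm (\<lambda>u. ip u v) \<le> norm v"
    using norm_ip_le by (intro onorm_bound) (auto simp: mult.commute)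
  have "(norm v)\<^sup>2 \<le> onorm (\<lambda>u. ip u v) * norm v"
    using onorm[OF bounded_linear_ip, of v v] by (simp add: ip_self del: of_real_power)
  then show "norm v \<le> onorm (\<lambda>u. ip u v)"
    using onorm_pos_le[OF bounded_linear_ip, of v] by (cases "v = 0") (auto simp: power2_eq_square)
qed

lemma range_pairing: "range \<nu> = dual_space sK" and inj_pairing: "inj \<nu>"
  using \<nu> unfolding isometric_iso_to_dual_def bij_betw_def by blast+

lemma pairing_dual: "\<nu> v \<in> dual_space sK"
  using range_pairing by blast

lemma bounded_linear_pairing: "bounded_linear (\<nu> v)"
  and pairing_sK_left: "\<nu> v (sK c u) = c * \<nu> v u"
  using pairing_dual[of v] by (simp_all add: bounded_operators_def)

lemma pairing_add_right: "\<nu> (v + w) u = \<nu> v u + \<nu> w u"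
  and pairing_sK_right: "\<nu> (sK c v) u = c * \<nu> v u"
  using \<nu> unfolding isometric_iso_to_dual_def by metis+

lemma pairing_scaleR_right: "\<nu> (r *\<^sub>R v) u = r *\<^sub>R \<nu> v u"
  using pairing_sK_right[of "of_real r"] by (simp add: sK_of_real scaleR_conv_of_real)

lemma norm_pairing_le: "norm (\<nu> v u) \<le> norm u * norm v"
  using onorm[OF bounded_linear_pairing, of v u] \<nu>
  by (simp add: isometric_iso_to_dual_def mult.commute)

lemma bounded_bilinear_pairing: "bounded_bilinear (pairing \<nu>)"
proof
  show "\<exists>K. \<forall>a b. norm (pairing \<nu> a b) \<le> norm a * norm b * K"
    using norm_pairing_le by (intro exI[of _ 1]) (simp add: pairing_def)
qed (simp_all add: pairing_def pairing_add_right pairing_scaleR_right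
    linear_simps(1,5)[OF bounded_linear_pairing])

text \<open>
  Since \<open>\<nu>\<close> is onto the dual space, it represents the functional given by the inner product with
  \<open>v\<close>. The map is conjugate-linear and isometric.
\<close>

definition riesz :: "'h \<Rightarrow> 'h" where
  "riesz v = (SOME w. \<nu> w = (\<lambda>u. ip u v))"

lemma pairing_riesz: "\<nu> (riesz v) u = ip u v"
proof -
  have "(\<lambda>u. ip u v) \<in> dual_space sK"
    using bounded_linear_ip ip_sK_left by (auto simp: bounded_operators_def)
  then have "\<exists>w. \<nu> w = (\<lambda>u. ip u v)"
    unfolding range_pairing[symmetric] by (metis rangeE)
  then show ?thesis
    unfolding riesz_def by (metis (mono_tags, lifting) someI_ex)
qed

lemma norm_riesz: "norm (riesz v) = norm v"
proof -
  have "\<nu> (riesz v) = (\<lambda>u. ip u v)"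
    using pairing_riesz by blast
  then show ?thesis
    using \<nu> onorm_ip[of v] by (metis isometric_iso_to_dual_def)
qed

lemma bounded_linear_riesz: "bounded_linear riesz"
proof -
  have inj: "v = w" if "\<nu> v = \<nu> w" for v w
    using inj_pairing that by (rule injD)
  have "riesz (v + w) = riesz v + riesz w" for v w
    by (rule inj) (auto simp: pairing_add_right pairing_riesz ip_add_right)
  moreover have "riesz (r *\<^sub>R v) = r *\<^sub>R riesz v" for r v
  proof (rule inj, rule ext)
    fix u
    have "cplx (ip u (r *\<^sub>R v)) = cplx (r *\<^sub>R ip u v)"
      unfolding cplx_scaleR ip_conjugate[of u v] ip_conjugate[of u "r *\<^sub>R v"] ip_scaleR_left by simp
    then show "\<nu> (riesz (r *\<^sub>R v)) u = \<nu> (r *\<^sub>R riesz v) u"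
      by (simp only: cplx_eq_iff pairing_riesz pairing_scaleR_right)
  qed
  ultimately show ?thesis
    by (intro bounded_linear_intro[where K = 1]) (auto simp: norm_riesz)
qed

text \<open>
  The gradient of \<open>v \<mapsto> |v|\<^sup>p / p\<close>, expressed through the pairing. At \<open>v = 0\<close> it vanishes for every
  exponent.
\<close>

definition dual_power :: "real \<Rightarrow> 'h \<Rightarrow> 'h" where
  "dual_power p v = norm v powr (p - 2) *\<^sub>R riesz v"

lemma norm_dual_power: "norm (dual_power p v) = norm v powr (p - 1)"
proof (cases "v = 0")
  case False
  then have "norm v powr (p - 2) * norm v powr 1 = norm v powr (p - 1)"
    by (subst powr_add[symmetric]) simp
  then show ?thesis
    by (simp add: dual_power_def norm_riesz)
qed (simp add: dual_power_def)

lemma pairing_dual_power: "pairing \<nu> u (dual_power p v) = norm v powr (p - 2) *\<^sub>R ip u v"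
  by (simp add: pairing_def dual_power_def pairing_scaleR_right pairing_riesz)

lemma pairing_dual_power_self: "pairing \<nu> v (dual_power p v) = of_real (norm v powr p)"
proof (cases "v = 0")
  case False
  then have "(norm v)\<^sup>2 = norm v powr 2"
    by simp
  then have "norm v powr (p - 2) * (norm v)\<^sup>2 = norm v powr p"
    by (simp only: powr_add[symmetric]) simp
  then show ?thesis
    unfolding pairing_dual_power ip_self scaleR_conv_of_real of_real_mult[symmetric] by simp
qed (simp add: pairing_dual_power ip_self)

text \<open>
  Convexity of \<open>v \<mapsto> |v|\<^sup>p\<close>, in the form of Young's inequality for \<open>|u|\<close> and \<open>|v|\<^bsup>p-1\<^esup>\<close>.
\<close>

lemma norm_powr_subgradient:
  assumes p: "1 < p"
  shows "norm v powr p + p * Re (cplx (pairing \<nu> (u - v) (dual_power p v))) \<le> norm u powr p"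
proof -
  interpret bounded_bilinear "pairing \<nu>" by (rule bounded_bilinear_pairing)
  define q where "q = p / (p - 1)"
  have q: "1 < q" "1 / p + 1 / q = 1" "(p - 1) * q = p" "p / q = p - 1"
    using p by (auto simp: q_def field_simps)
  have "Re (cplx (pairing \<nu> u (dual_power p v))) \<le> norm (pairing \<nu> u (dual_power p v))"
    using complex_Re_le_cmod[of "cplx (pairing \<nu> u (dual_power p v))"] by (simp add: norm_cplx)
  also have "\<dots> \<le> norm u * norm v powr (p - 1)"
    using norm_pairing_le[of "dual_power p v" u] by (simp add: pairing_def norm_dual_power)
  also have "\<dots> \<le> norm u powr p / p + (norm v powr (p - 1)) powr q / q"
    using p q by (intro Youngs_inequality) auto
  also have "(norm v powr (p - 1)) powr q = norm v powr p"
    by (simp add: powr_powr q)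
  finally have "p * Re (cplx (pairing \<nu> u (dual_power p v))) \<le> p * (norm u powr p / p + norm v powr p / q)"
    using p by (intro mult_left_mono) auto
  also have "\<dots> = norm u powr p + (p / q) * norm v powr p"
    using p by (simp add: distrib_left)
  also have "\<dots> = norm u powr p + (p - 1) * norm v powr p"
    by (simp only: q)
  finally have *: "p * Re (cplx (pairing \<nu> u (dual_power p v))) \<le> norm u powr p + (p - 1) * norm v powr p" .
  have "Re (cplx (pairing \<nu> (u - v) (dual_power p v))) =
      Re (cplx (pairing \<nu> u (dual_power p v))) - norm v powr p"
    by (simp add: diff_left pairing_dual_power_self cplx_diff)
  then have "p * Re (cplx (pairing \<nu> (u - v) (dual_power p v))) =
      p * Re (cplx (pairing \<nu> u (dual_power p v))) - p * norm v powr p"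
    by (simp add: right_diff_distrib)
  then show ?thesis
    using * by (simp add: left_diff_distrib)
qed

text \<open>
  At \<open>0\<close> the factor \<open>|v|\<^bsup>p-2\<^esup>\<close> may be unbounded, and the norm \<open>|v|\<^bsup>p-1\<^esup>\<close> of the product gives
  convergence.
\<close>

lemma tendsto_dual_power:
  assumes p: "1 < p" and lim: "(f \<longlongrightarrow> v) F"
  shows "((\<lambda>x. dual_power p (f x)) \<longlongrightarrow> dual_power p v) F"
proof (cases "v = 0")
  case False
  then show ?thesis
    unfolding dual_power_def
    by (intro tendsto_intros lim bounded_linear.tendsto[OF bounded_linear_riesz]) auto
next
  case True
  have "((\<lambda>x. norm (f x) powr (p - 1)) \<longlongrightarrow> norm v powr (p - 1)) F"
    using p by (intro tendsto_powr' tendsto_intros lim) auto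
  then have "((\<lambda>x. norm (dual_power p (f x))) \<longlongrightarrow> 0) F"
    using True by (simp add: norm_dual_power)
  then have "((\<lambda>x. dual_power p (f x)) \<longlongrightarrow> 0) F"
    by (rule tendsto_norm_zero_cancel)
  then show ?thesis
    using True by (simp add: dual_power_def)
qed

end


section \<open>Bochner measurable functions\<close>

lemma bochner_measurableI:
  assumes "\<And>n. simple_function M (s n)" "AE \<omega> in M. (\<lambda>n. s n \<omega>) \<longlonglongrightarrow> f \<omega>"
  shows "bochner_measurable M f"
  unfolding bochner_measurable_def
  using assms by (intro exI[of _ s]) (auto simp: tendsto_norm_zero_iff LIM_zero_iff)

lemma bochner_measurableE:
  assumes "bochner_measurable M f"
  obtains s where "\<And>n. simple_function M (s n)" "AE \<omega> in M. (\<lambda>n. s n \<omega>) \<longlonglongrightarrow> f \<omega>"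
  using assms unfolding bochner_measurable_def tendsto_norm_zero_iff LIM_zero_iff by blast

text \<open>
  Simple functions for the completion agree almost everywhere with simple functions for the measure,
  and a sequence of them involves only countably many null sets.
\<close>

lemma bochner_measurable_completion_iff:
  "bochner_measurable (completion M) f \<longleftrightarrow> bochner_measurable M f"
proof
  assume "bochner_measurable M f"
  then obtain s where "\<And>n. simple_function M (s n)" "AE \<omega> in M. (\<lambda>n. s n \<omega>) \<longlonglongrightarrow> f \<omega>"
    by (rule bochner_measurableE) blast
  then show "bochner_measurable (completion M) f"
    by (intro bochner_measurableI[of _ s]) (auto intro: simple_function_completion AE_completion)
next
  assume "bochner_measurable (completion M) f"
  then obtain s where s: "\<And>n. simple_function (completion M) (s n)"
      "AE \<omega> in completion M. (\<lambda>n. s n \<omega>) \<longlonglongrightarrow> f \<omega>"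
    by (rule bochner_measurableE) blast
  have "\<forall>n. \<exists>t. simple_function M t \<and> (AE \<omega> in M. s n \<omega> = t \<omega>)"
    using completion_ex_simple_function[OF s(1)] by blast
  then obtain t where t: "\<And>n. simple_function M (t n)" "\<And>n. AE \<omega> in M. s n \<omega> = t n \<omega>"
    by metis
  have "AE \<omega> in M. \<forall>n. s n \<omega> = t n \<omega>"
    using t(2) by (simp add: AE_all_countable)
  moreover have "AE \<omega> in M. (\<lambda>n. s n \<omega>) \<longlonglongrightarrow> f \<omega>"
    using s(2) by (simp add: AE_completion_iff)
  ultimately have "AE \<omega> in M. (\<lambda>n. t n \<omega>) \<longlonglongrightarrow> f \<omega>"
    by eventually_elim simp
  then show "bochner_measurable M f"
    using t(1) by (intro bochner_measurableI)
qed

lemma bochner_measurable_compose2: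
  assumes f: "bochner_measurable M f" and g: "bochner_measurable M g"
    and h: "\<And>x y a b. x \<longlonglongrightarrow> a \<Longrightarrow> y \<longlonglongrightarrow> b \<Longrightarrow> (\<lambda>n. h (x n) (y n)) \<longlonglongrightarrow> h a b"
  shows "bochner_measurable M (\<lambda>\<omega>. h (f \<omega>) (g \<omega>))"
proof -
  obtain s where s: "\<And>n. simple_function M (s n)" "AE \<omega> in M. (\<lambda>n. s n \<omega>) \<longlonglongrightarrow> f \<omega>"
    using f by (rule bochner_measurableE) blast
  obtain t where t: "\<And>n. simple_function M (t n)" "AE \<omega> in M. (\<lambda>n. t n \<omega>) \<longlonglongrightarrow> g \<omega>"
    using g by (rule bochner_measurableE) blast
  show ?thesis
  proof (rule bochner_measurableI)
    show "simple_function M (\<lambda>\<omega>. h (s n \<omega>) (t n \<omega>))" for n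
      by (rule simple_function_compose2[OF s(1) t(1)])
    show "AE \<omega> in M. (\<lambda>n. h (s n \<omega>) (t n \<omega>)) \<longlonglongrightarrow> h (f \<omega>) (g \<omega>)"
      using s(2) t(2) by eventually_elim (rule h)
  qed
qed

lemma bochner_measurable_compose:
  assumes "bochner_measurable M f" "\<And>x a. x \<longlonglongrightarrow> a \<Longrightarrow> (\<lambda>n. h (x n)) \<longlonglongrightarrow> h a"
  shows "bochner_measurable M (\<lambda>\<omega>. h (f \<omega>))"
  by (rule bochner_measurable_compose2[OF assms(1,1), of "\<lambda>a b. h a"]) (rule assms(2))

lemma bochner_measurable_borel:
  fixes f :: "'w \<Rightarrow> real"
  assumes "f \<in> borel_measurable M"
  shows "bochner_measurable M f"
proof -
  obtain s where s: "\<forall>n. simple_function M (s n)" "\<forall>\<omega>\<in>space M. (\<lambda>n. s n \<omega>) \<longlonglongrightarrow> f \<omega>"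
    using borel_measurable_implies_sequence_metric[OF assms, of 0] by blast
  then show ?thesis
    by (intro bochner_measurableI[of _ s]) auto
qed

text \<open>
  Off a null set the function is a pointwise limit of simple functions. On the null set it is
  arbitrary, which is why measurability holds for the completed measure.
\<close>

lemma borel_measurable_bochner:
  fixes f :: "'w \<Rightarrow> 'b::real_normed_vector"
  assumes "bochner_measurable M f"
  shows "f \<in> borel_measurable (completion M)"
proof -
  obtain s where s: "\<And>n. simple_function M (s n)" "AE \<omega> in M. (\<lambda>n. s n \<omega>) \<longlonglongrightarrow> f \<omega>"
    using assms by (rule bochner_measurableE) blast
  define A where "A = {\<omega> \<in> space M. (\<lambda>n. s n \<omega>) \<longlonglongrightarrow> f \<omega>}"
  have "AE \<omega> in M. \<omega> \<in> A"
    using s(2) AE_space by eventually_elim (simp add: A_def)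
  then have "Measurable.pred (completion M) (\<lambda>\<omega>. \<omega> \<notin> A)"
    by (intro sets_completion_AE) simp
  then have "{\<omega> \<in> space (completion M). \<omega> \<notin> A} \<in> sets (completion M)"
    by (simp only: pred_def)
  then have "space (completion M) - {\<omega> \<in> space (completion M). \<omega> \<notin> A} \<in> sets (completion M)"
    by blast
  also have "space (completion M) - {\<omega> \<in> space (completion M). \<omega> \<notin> A} = A"
    by (auto simp: A_def)
  finally have A: "A \<in> sets (completion M)" .
  define g where "g \<omega> = (if \<omega> \<in> A then f \<omega> else 0)" for \<omega>
  have s_meas: "s n \<in> borel_measurable (completion M)" for n
    by (intro borel_measurable_simple_function simple_function_completion s)
  have g: "g \<in> borel_measurable (completion M)"
  proof (rule borel_measurable_LIMSEQ_metric)
    show "(\<lambda>\<omega>. if \<omega> \<in> A then s n \<omega> else 0) \<in> borel_measurable (completion M)" for n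
      using A s_meas by (intro measurable_If_set) auto
    show "(\<lambda>n. if \<omega> \<in> A then s n \<omega> else 0) \<longlonglongrightarrow> g \<omega>" for \<omega>
      by (auto simp: g_def A_def)
  qed
  have "AE \<omega> in M. g \<omega> = f \<omega>"
    using \<open>AE \<omega> in M. \<omega> \<in> A\<close> by eventually_elim (simp add: g_def)
  then have ae: "AE \<omega> in completion M. g \<omega> = f \<omega>"
    by (rule AE_completion)
  show ?thesis
  proof (rule measurableI)
    fix B :: "'b set"
    assume "B \<in> sets borel"
    with g have "g -` B \<inter> space (completion M) \<in> sets (completion M)"
      by (rule measurable_sets)
    from _ this show "f -` B \<inter> space (completion M) \<in> sets (completion M)"
    proof (rule completion.in_sets_AE)
      show "AE \<omega> in completion M.
        \<omega> \<in> g -` B \<inter> space (completion M) \<longleftrightarrow> \<omega> \<in> f -` B \<inter> space (completion M)"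
        using ae by eventually_elim simp
    qed auto
  qed auto
qed


section \<open>Bochner spaces\<close>

lemma borel_measurable_norm_powr:
  fixes F :: "'w \<Rightarrow> 'b::real_normed_vector"
  assumes "bochner_measurable M F"
  shows "(\<lambda>\<omega>. norm (F \<omega>)) \<in> borel_measurable (completion M)"
    and "(\<lambda>\<omega>. norm (F \<omega>) powr r) \<in> borel_measurable (completion M)"
proof -
  have "bochner_measurable M (\<lambda>\<omega>. norm (F \<omega>))"
    using assms by (rule bochner_measurable_compose) (rule tendsto_norm)
  then show norm: "(\<lambda>\<omega>. norm (F \<omega>)) \<in> borel_measurable (completion M)"
    by (rule borel_measurable_bochner)
  show "(\<lambda>\<omega>. norm (F \<omega>) powr r) \<in> borel_measurable (completion M)"
    using norm by measurable
qed

lemma Lr_iff: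
  "F \<in> Lr M r \<longleftrightarrow>
     bochner_measurable M F \<and> integrable (completion M) (\<lambda>\<omega>. norm (F \<omega>) powr r)"
  using borel_measurable_norm_powr(2)[of M F r]
  by (auto simp: Lr_def integrable_iff_bounded nn_integral_completion)

lemma Lr_norm_eq:
  assumes "bochner_measurable M F"
  shows "Lr_norm M r F = (\<integral>\<omega>. norm (F \<omega>) powr r \<partial>completion M) powr (1 / r)"
proof -
  have "(\<integral>\<omega>. norm (F \<omega>) powr r \<partial>completion M) =
      enn2real (\<integral>\<^sup>+\<omega>. ennreal (norm (F \<omega>) powr r) \<partial>completion M)"
    using borel_measurable_norm_powr(2)[OF assms] by (intro integral_eq_nn_integral) auto
  then show ?thesis
    by (simp add: Lr_norm_def nn_integral_completion)
qed

lemma Lr_norm_nonneg: "0 \<le> Lr_norm M r F"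
  by (simp add: Lr_norm_def)

lemma bochner_measurable_scaleR:
  "bochner_measurable M f \<Longrightarrow> bochner_measurable M G \<Longrightarrow> bochner_measurable M (\<lambda>\<omega>. f \<omega> *\<^sub>R G \<omega>)"
  by (rule bochner_measurable_compose2[of _ _ _ "(*\<^sub>R)"]) (auto intro: tendsto_scaleR)

context hilbert_pairing
begin

lemma integrable_pairing:
  assumes p: "1 < p" and pq: "1 / p + 1 / q = 1" and F: "F \<in> Lr M p" and G: "G \<in> Lr M q"
  shows "integrable (completion M) (\<lambda>\<omega>. pairing \<nu> (F \<omega>) (G \<omega>))"
    and "norm (\<integral>\<omega>. pairing \<nu> (F \<omega>) (G \<omega>) \<partial>completion M) \<le> Lr_norm M p F * Lr_norm M q G"
proof -
  interpret bounded_bilinear "pairing \<nu>" by (rule bounded_bilinear_pairing)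
  have q: "1 < q"
    using conjugate_exponent[OF p pq] by simp
  note F = F[unfolded Lr_iff] and G = G[unfolded Lr_iff]
  note Hoelder = Hoelder_inequality[OF p q pq borel_measurable_norm_powr(1)[OF conjunct1[OF F]] _ conjunct2[OF F]
    borel_measurable_norm_powr(1)[OF conjunct1[OF G]] _ conjunct2[OF G]]
  have "bochner_measurable M (\<lambda>\<omega>. pairing \<nu> (F \<omega>) (G \<omega>))"
    using F G by (intro bochner_measurable_compose2[of _ _ _ "pairing \<nu>"]) (auto intro: tendsto)
  then have meas: "(\<lambda>\<omega>. pairing \<nu> (F \<omega>) (G \<omega>)) \<in> borel_measurable (completion M)"
    by (rule borel_measurable_bochner)
  have le: "norm (pairing \<nu> (F \<omega>) (G \<omega>)) \<le> norm (F \<omega>) * norm (G \<omega>)" for \<omega>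
    using norm_pairing_le by (simp add: pairing_def)
  show int: "integrable (completion M) (\<lambda>\<omega>. pairing \<nu> (F \<omega>) (G \<omega>))"
    using le by (intro Bochner_Integration.integrable_bound[OF Hoelder(1) meas]) auto
  have "norm (\<integral>\<omega>. pairing \<nu> (F \<omega>) (G \<omega>) \<partial>completion M) \<le>
      (\<integral>\<omega>. norm (pairing \<nu> (F \<omega>) (G \<omega>)) \<partial>completion M)"
    by (rule integral_norm_bound)
  also have "\<dots> \<le> (\<integral>\<omega>. norm (F \<omega>) * norm (G \<omega>) \<partial>completion M)"
    using int le by (intro integral_mono integrable_norm Hoelder(1)) auto
  also have "\<dots> \<le> Lr_norm M p F * Lr_norm M q G"
    using Hoelder(2) F G by (simp add: Lr_norm_eq)
  finally show "norm (\<integral>\<omega>. pairing \<nu> (F \<omega>) (G \<omega>) \<partial>completion M) \<le> Lr_norm M p F * Lr_norm M q G" .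
qed

lemma bochner_measurable_dual_power:
  assumes "1 < p" "bochner_measurable M F"
  shows "bochner_measurable M (\<lambda>\<omega>. dual_power p (F \<omega>))"
  using assms(2) by (rule bochner_measurable_compose) (rule tendsto_dual_power[OF assms(1)])

text \<open>
  Since \<open>(p - 1) q = p\<close>, the \<open>q\<close>-th power of the norm of the image is the \<open>p\<close>-th power of the norm
  of \<open>F\<close>.
\<close>

lemma Lr_dual_power:
  assumes p: "1 < p" and pq: "1 / p + 1 / q = 1" and F: "F \<in> Lr M p"
  shows "(\<lambda>\<omega>. dual_power p (F \<omega>)) \<in> Lr M q"
    and "Lr_norm M q (\<lambda>\<omega>. dual_power p (F \<omega>)) = (\<integral>\<omega>. norm (F \<omega>) powr p \<partial>completion M) powr (1 / q)"
proof -
  have "norm (dual_power p (F \<omega>)) powr q = norm (F \<omega>) powr p" for \<omega>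
    using conjugate_exponent[OF p pq] by (simp add: norm_dual_power powr_powr)
  then show "(\<lambda>\<omega>. dual_power p (F \<omega>)) \<in> Lr M q"
    "Lr_norm M q (\<lambda>\<omega>. dual_power p (F \<omega>)) = (\<integral>\<omega>. norm (F \<omega>) powr p \<partial>completion M) powr (1 / q)"
    using F bochner_measurable_dual_power[OF p, of M F] by (auto simp: Lr_iff Lr_norm_eq)
qed

end


section \<open>Analysis and synthesis operators\<close>

locale operator_family = hilbert_pairing sK ip \<nu>
  for sK :: "'k::real_or_complex \<Rightarrow> 'h::banach \<Rightarrow> 'h" and ip \<nu> +
  fixes M :: "'w measure" and sX :: "'k \<Rightarrow> 'x::banach \<Rightarrow> 'x" and \<Lambda> :: "'w \<Rightarrow> 'x \<Rightarrow> 'h"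
    and p q :: real
  assumes sX: "scalar_mult sX" and p: "1 < p" and pq: "1 / p + 1 / q = 1"
    and bounded_linear_family: "\<And>\<omega>. \<omega> \<in> space M \<Longrightarrow> bounded_linear (\<Lambda> \<omega>)"
    and family_scale: "\<And>\<omega> c x. \<omega> \<in> space M \<Longrightarrow> \<Lambda> \<omega> (sX c x) = sK c (\<Lambda> \<omega> x)"
    and measurable_family: "\<And>x. bochner_measurable M (\<lambda>\<omega>. \<Lambda> \<omega> x)"
begin

lemma family_add: "\<omega> \<in> space M \<Longrightarrow> \<Lambda> \<omega> (x + y) = \<Lambda> \<omega> x + \<Lambda> \<omega> y"
  and family_diff: "\<omega> \<in> space M \<Longrightarrow> \<Lambda> \<omega> (x - y) = \<Lambda> \<omega> x - \<Lambda> \<omega> y"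
  and family_scaleR: "\<omega> \<in> space M \<Longrightarrow> \<Lambda> \<omega> (r *\<^sub>R x) = r *\<^sub>R \<Lambda> \<omega> x"
  using linear_simps[OF bounded_linear_family] by auto

definition energy :: "'x \<Rightarrow> real" where
  "energy x = (\<integral>\<omega>. norm (\<Lambda> \<omega> x) powr p \<partial>completion M)"

lemma energy_nonneg: "0 \<le> energy x"
  by (simp add: energy_def)

lemma Lr_norm_family: "Lr_norm M p (\<lambda>\<omega>. \<Lambda> \<omega> x) = energy x powr (1 / p)"
  using measurable_family by (simp add: Lr_norm_eq energy_def)

lemma Lr_norm_family_scaleR:
  "Lr_norm M p (\<lambda>\<omega>. \<Lambda> \<omega> (r *\<^sub>R x)) = \<bar>r\<bar> * Lr_norm M p (\<lambda>\<omega>. \<Lambda> \<omega> x)"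
proof -
  have "energy (r *\<^sub>R x) = (\<integral>\<omega>. \<bar>r\<bar> powr p * norm (\<Lambda> \<omega> x) powr p \<partial>completion M)"
    unfolding energy_def
    by (intro Bochner_Integration.integral_cong) (auto simp: family_scaleR powr_mult)
  also have "\<dots> = \<bar>r\<bar> powr p * energy x"
    by (simp add: energy_def)
  finally show ?thesis
    using p energy_nonneg[of x] by (simp add: Lr_norm_family powr_mult powr_powr)
qed

lemma synthesis_dual:
  assumes Lp: "\<And>x. (\<lambda>\<omega>. \<Lambda> \<omega> x) \<in> Lr M p"
    and B: "0 \<le> B" and bound: "\<And>x. Lr_norm M p (\<lambda>\<omega>. \<Lambda> \<omega> x) \<le> B * norm x" and G: "G \<in> Lr M q"
  shows "synthesis M \<nu> \<Lambda> G \<in> dual_space sX"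
    and "onorm (synthesis M \<nu> \<Lambda> G) \<le> B * Lr_norm M q G"
proof -
  interpret bounded_bilinear "pairing \<nu>" by (rule bounded_bilinear_pairing)
  note int = integrable_pairing(1)[OF p pq Lp G]
  have le: "norm (synthesis M \<nu> \<Lambda> G x) \<le> (B * Lr_norm M q G) * norm x" for x
  proof -
    have "norm (synthesis M \<nu> \<Lambda> G x) \<le> Lr_norm M p (\<lambda>\<omega>. \<Lambda> \<omega> x) * Lr_norm M q G"
      unfolding synthesis_def by (rule integrable_pairing(2)[OF p pq Lp G])
    also have "\<dots> \<le> (B * norm x) * Lr_norm M q G"
      using bound by (intro mult_right_mono Lr_norm_nonneg)
    finally show ?thesis
      by (simp add: ac_simps)
  qed
  have hom: "synthesis M \<nu> \<Lambda> G (sX c x) = c * synthesis M \<nu> \<Lambda> G x" for c x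
  proof -
    have "synthesis M \<nu> \<Lambda> G (sX c x) = (\<integral>\<omega>. c * pairing \<nu> (\<Lambda> \<omega> x) (G \<omega>) \<partial>completion M)"
      unfolding synthesis_def
      by (intro Bochner_Integration.integral_cong) (auto simp: family_scale pairing_def pairing_sK_left)
    then show ?thesis
      by (simp add: synthesis_def)
  qed
  have "synthesis M \<nu> \<Lambda> G (x + y) = synthesis M \<nu> \<Lambda> G x + synthesis M \<nu> \<Lambda> G y" for x y
  proof -
    have "synthesis M \<nu> \<Lambda> G (x + y) =
        (\<integral>\<omega>. pairing \<nu> (\<Lambda> \<omega> x) (G \<omega>) + pairing \<nu> (\<Lambda> \<omega> y) (G \<omega>) \<partial>completion M)"
      unfolding synthesis_def
      by (intro Bochner_Integration.integral_cong) (auto simp: family_add add_left)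
    then show ?thesis
      using int by (simp add: synthesis_def)
  qed
  moreover have "synthesis M \<nu> \<Lambda> G (r *\<^sub>R x) = r *\<^sub>R synthesis M \<nu> \<Lambda> G x" for r x
    using hom[of "of_real r" x] by (simp add: scalar_mult_of_real[OF sX] scaleR_conv_of_real)
  ultimately have "bounded_linear (synthesis M \<nu> \<Lambda> G)"
    using le by (intro bounded_linear_intro[where K = "B * Lr_norm M q G"]) (auto simp: mult.commute)
  then show "synthesis M \<nu> \<Lambda> G \<in> dual_space sX"
    using hom by (simp add: bounded_operators_def)
  show "onorm (synthesis M \<nu> \<Lambda> G) \<le> B * Lr_norm M q G"
    using B le by (intro onorm_bound mult_nonneg_nonneg Lr_norm_nonneg)
qed

text \<open>
  The subgradient theorem applied to the energy. Its subgradient at \<open>v\<close> is the real part of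
  \<open>T (D v)\<close>, where \<open>D v\<close> is the pointwise gradient along \<open>\<Lambda> \<omega> v\<close>. Coercivity is the lower frame
  bound, the subgradient inequality and uniform convexity are integrals of the corresponding
  inequalities in \<open>K\<close>, and continuity along lines is dominated convergence.
\<close>

lemma synthesis_surjective:
  assumes Lp: "\<And>x. (\<lambda>\<omega>. \<Lambda> \<omega> x) \<in> Lr M p"
    and A: "0 < A" and lower: "\<And>x. A * norm x \<le> Lr_norm M p (\<lambda>\<omega>. \<Lambda> \<omega> x)"
    and B: "0 \<le> B" and upper: "\<And>x. Lr_norm M p (\<lambda>\<omega>. \<Lambda> \<omega> x) \<le> B * norm x"
    and \<phi>: "\<phi> \<in> dual_space sX"
  shows "\<exists>G\<in>Lr M q. synthesis M \<nu> \<Lambda> G = \<phi>"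
proof -
  let ?N = "completion M"
  interpret bounded_bilinear "pairing \<nu>" by (rule bounded_bilinear_pairing)
  interpret Re_cplx: bounded_linear "\<lambda>a::'k. Re (cplx a)" by (rule bounded_linear_Re_cplx)
  define D where "D v = (\<lambda>\<omega>. dual_power p (\<Lambda> \<omega> v))" for v
  have D: "D v \<in> Lr M q" for v
    unfolding D_def by (rule Lr_dual_power[OF p pq Lp])
  have dual: "synthesis M \<nu> \<Lambda> (D v) \<in> dual_space sX" for v
    by (rule synthesis_dual[OF Lp B upper D])
  define g where "g v x = Re (cplx (synthesis M \<nu> \<Lambda> (D v) x))" for v x
  have int_p: "integrable ?N (\<lambda>\<omega>. norm (\<Lambda> \<omega> x) powr p)" for x
    using Lp by (simp add: Lr_iff)
  have int_pair: "integrable ?N (\<lambda>\<omega>. pairing \<nu> (\<Lambda> \<omega> x) (D v \<omega>))" for x v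
    by (rule integrable_pairing(1)[OF p pq Lp D])
  have g_eq: "g v x = (\<integral>\<omega>. Re (cplx (pairing \<nu> (\<Lambda> \<omega> x) (D v \<omega>))) \<partial>?N)" for v x
    unfolding g_def synthesis_def by (rule integral_bounded_linear[OF bounded_linear_Re_cplx int_pair, symmetric])
  have int_g: "integrable ?N (\<lambda>\<omega>. Re (cplx (pairing \<nu> (\<Lambda> \<omega> x) (D v \<omega>))))" for x v
    by (rule integrable_bounded_linear[OF bounded_linear_Re_cplx int_pair])
  have "\<exists>v. g v = (\<lambda>x. Re (cplx (\<phi> x)))"
  proof (rule subgradient_map_onto[where N = energy])
    show "1 < p" "0 < A powr p"
      using p A by auto
    show "A powr p * norm x powr p \<le> energy x" for x
    proof -
      have "(A * norm x) powr p \<le> (energy x powr (1 / p)) powr p"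
        using lower[of x] A p unfolding Lr_norm_family by (intro powr_mono2) auto
      then show ?thesis
        using A p energy_nonneg[of x] by (simp add: powr_mult powr_powr)
    qed
    show "bounded_linear (g v)" for v
      using bounded_linear_compose[OF bounded_linear_Re_cplx, of "synthesis M \<nu> \<Lambda> (D v)"] dual[of v]
      by (simp add: bounded_operators_def g_def[abs_def])
    show "bounded_linear (\<lambda>x. Re (cplx (\<phi> x)))"
      using bounded_linear_compose[OF bounded_linear_Re_cplx, of \<phi>] \<phi>
      by (simp add: bounded_operators_def)
    show "energy v + p * g v (u - v) \<le> energy u" for u v
    proof -
      have "energy v + p * g v (u - v) =
          (\<integral>\<omega>. norm (\<Lambda> \<omega> v) powr p + p * Re (cplx (pairing \<nu> (\<Lambda> \<omega> (u - v)) (D v \<omega>))) \<partial>?N)"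
        using int_p int_g by (simp add: energy_def g_eq)
      also have "\<dots> \<le> energy u"
        unfolding energy_def
      proof (rule integral_mono)
        fix \<omega> assume "\<omega> \<in> space ?N"
        then show "norm (\<Lambda> \<omega> v) powr p + p * Re (cplx (pairing \<nu> (\<Lambda> \<omega> (u - v)) (D v \<omega>))) \<le>
            norm (\<Lambda> \<omega> u) powr p"
          using norm_powr_subgradient[OF p, of "\<Lambda> \<omega> v" "\<Lambda> \<omega> u"] by (simp add: family_diff D_def)
      qed (use int_p int_g in auto)
      finally show ?thesis .
    qed
    show "(\<lambda>n. g (v + (1 / real (Suc n)) *\<^sub>R x) x) \<longlonglongrightarrow> g v x" for v x
      unfolding g_eq
    proof (rule integral_dominated_convergence)
      define w where "w \<omega> = 2 powr p * (norm (\<Lambda> \<omega> v) powr p + norm (\<Lambda> \<omega> x) powr p)" for \<omega>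
      show "integrable ?N w"
        unfolding w_def[abs_def] using int_p by auto
      show "AE \<omega> in ?N. (\<lambda>n. Re (cplx (pairing \<nu> (\<Lambda> \<omega> x) (D (v + (1 / real (Suc n)) *\<^sub>R x) \<omega>))))
          \<longlonglongrightarrow> Re (cplx (pairing \<nu> (\<Lambda> \<omega> x) (D v \<omega>)))"
      proof (rule AE_I2)
        fix \<omega> assume "\<omega> \<in> space ?N"
        then have \<omega>: "\<omega> \<in> space M"
          by simp
        have "(\<lambda>n. \<Lambda> \<omega> v + (1 / real (Suc n)) *\<^sub>R \<Lambda> \<omega> x) \<longlonglongrightarrow> \<Lambda> \<omega> v + 0 *\<^sub>R \<Lambda> \<omega> x"
          using LIMSEQ_Suc[OF lim_1_over_n[where 'a = real]] by (intro tendsto_intros)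
        then have "(\<lambda>n. \<Lambda> \<omega> (v + (1 / real (Suc n)) *\<^sub>R x)) \<longlonglongrightarrow> \<Lambda> \<omega> v"
          by (simp add: family_add[OF \<omega>] family_scaleR[OF \<omega>])
        then show "(\<lambda>n. Re (cplx (pairing \<nu> (\<Lambda> \<omega> x) (D (v + (1 / real (Suc n)) *\<^sub>R x) \<omega>))))
          \<longlonglongrightarrow> Re (cplx (pairing \<nu> (\<Lambda> \<omega> x) (D v \<omega>)))"
          unfolding D_def by (intro Re_cplx.tendsto tendsto tendsto_const tendsto_dual_power[OF p])
      qed
      show "AE \<omega> in ?N. norm (Re (cplx (pairing \<nu> (\<Lambda> \<omega> x) (D (v + (1 / real (Suc n)) *\<^sub>R x) \<omega>)))) \<le> w \<omega>" for n
      proof (rule AE_I2)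
        fix \<omega> assume "\<omega> \<in> space ?N"
        then have \<omega>: "\<omega> \<in> space M"
          by simp
        define t where "t = 1 / real (Suc n)"
        have t: "0 \<le> t" "t \<le> 1"
          by (auto simp: t_def)
        define r where "r = norm (\<Lambda> \<omega> v) + norm (\<Lambda> \<omega> x)"
        have "norm (\<Lambda> \<omega> (v + t *\<^sub>R x)) \<le> norm (\<Lambda> \<omega> v) + t * norm (\<Lambda> \<omega> x)"
          using norm_triangle_ineq[of "\<Lambda> \<omega> v" "t *\<^sub>R \<Lambda> \<omega> x"] t
          by (simp add: family_add[OF \<omega>] family_scaleR[OF \<omega>])
        also have "\<dots> \<le> r"
          using t by (simp add: r_def mult_left_le_one_le)
        finally have le: "norm (\<Lambda> \<omega> (v + t *\<^sub>R x)) \<le> r" .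
        have "norm (Re (cplx (pairing \<nu> (\<Lambda> \<omega> x) (D (v + t *\<^sub>R x) \<omega>)))) \<le>
            norm (pairing \<nu> (\<Lambda> \<omega> x) (D (v + t *\<^sub>R x) \<omega>))"
          using abs_Re_le_cmod[of "cplx (pairing \<nu> (\<Lambda> \<omega> x) (D (v + t *\<^sub>R x) \<omega>))"] by (simp add: norm_cplx)
        also have "\<dots> \<le> norm (\<Lambda> \<omega> x) * norm (D (v + t *\<^sub>R x) \<omega>)"
          using norm_pairing_le by (simp add: pairing_def)
        also have "\<dots> \<le> r * r powr (p - 1)"
          unfolding D_def norm_dual_power using le p
          by (intro mult_mono powr_mono2) (auto simp: r_def)
        also have "\<dots> = r powr p"
          by (simp add: powr_mult_base r_def)
        also have "\<dots> \<le> w \<omega>"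
          unfolding r_def w_def by (rule add_powr_le[OF p]) auto
        finally show "norm (Re (cplx (pairing \<nu> (\<Lambda> \<omega> x) (D (v + (1 / real (Suc n)) *\<^sub>R x) \<omega>)))) \<le> w \<omega>"
          by (simp only: t_def)
      qed
    qed (use int_g in \<open>auto dest: borel_measurable_integrable\<close>)
    fix \<epsilon> :: real
    assume "0 < \<epsilon>"
    then obtain C where C: "0 < C" "\<And>a b d m. 0 \<le> a \<Longrightarrow> 0 \<le> b \<Longrightarrow> 0 \<le> m \<Longrightarrow> \<bar>a - b\<bar> \<le> d \<Longrightarrow> d \<le> a + b \<Longrightarrow>
       m\<^sup>2 = (a\<^sup>2 + b\<^sup>2) / 2 - d\<^sup>2 / 4 \<Longrightarrow>
       d powr p \<le> \<epsilon> * (a powr p + b powr p) + C * ((a powr p + b powr p) / 2 - m powr p)"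
      using uniform_convexity[OF p] by metis
    show "\<exists>C>0. \<forall>x y. energy (x - y) \<le> \<epsilon> * (energy x + energy y) +
        C * ((energy x + energy y) / 2 - energy ((1 / 2) *\<^sub>R (x + y)))"
    proof (intro exI conjI allI)
      fix x y
      have "energy (x - y) \<le> (\<integral>\<omega>. \<epsilon> * (norm (\<Lambda> \<omega> x) powr p + norm (\<Lambda> \<omega> y) powr p) +
          C * ((norm (\<Lambda> \<omega> x) powr p + norm (\<Lambda> \<omega> y) powr p) / 2 -
            norm (\<Lambda> \<omega> ((1 / 2) *\<^sub>R (x + y))) powr p) \<partial>?N)"
        unfolding energy_def
      proof (rule integral_mono)
        fix \<omega> assume "\<omega> \<in> space ?N"
        then have \<omega>: "\<omega> \<in> space M"
          by simp
        show "norm (\<Lambda> \<omega> (x - y)) powr p \<le> \<epsilon> * (norm (\<Lambda> \<omega> x) powr p + norm (\<Lambda> \<omega> y) powr p) +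
          C * ((norm (\<Lambda> \<omega> x) powr p + norm (\<Lambda> \<omega> y) powr p) / 2 -
            norm (\<Lambda> \<omega> ((1 / 2) *\<^sub>R (x + y))) powr p)"
        proof (rule C(2))
          show "\<bar>norm (\<Lambda> \<omega> x) - norm (\<Lambda> \<omega> y)\<bar> \<le> norm (\<Lambda> \<omega> (x - y))"
            by (simp add: family_diff[OF \<omega>] norm_triangle_ineq3)
          show "norm (\<Lambda> \<omega> (x - y)) \<le> norm (\<Lambda> \<omega> x) + norm (\<Lambda> \<omega> y)"
            by (simp add: family_diff[OF \<omega>] norm_triangle_ineq4)
          show "(norm (\<Lambda> \<omega> ((1 / 2) *\<^sub>R (x + y))))\<^sup>2 =
              ((norm (\<Lambda> \<omega> x))\<^sup>2 + (norm (\<Lambda> \<omega> y))\<^sup>2) / 2 - (norm (\<Lambda> \<omega> (x - y)))\<^sup>2 / 4"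
            using parallelogram[of "\<Lambda> \<omega> x" "\<Lambda> \<omega> y"]
            unfolding family_scaleR[OF \<omega>] family_add[OF \<omega>] family_diff[OF \<omega>] norm_scaleR power_mult_distrib
            by (simp add: power2_eq_square field_simps)
        qed auto
      qed (intro Bochner_Integration.integrable_add Bochner_Integration.integrable_diff
          integrable_mult_right integrable_divide int_p)+
      also have "\<dots> = \<epsilon> * (energy x + energy y) +
          C * ((energy x + energy y) / 2 - energy ((1 / 2) *\<^sub>R (x + y)))"
        unfolding energy_def using int_p by simp
      finally show "energy (x - y) \<le> \<epsilon> * (energy x + energy y) +
          C * ((energy x + energy y) / 2 - energy ((1 / 2) *\<^sub>R (x + y)))" .
    qed (rule C(1))
  qed
  then obtain v where v: "\<And>x. g v x = Re (cplx (\<phi> x))"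
    by metis
  have "synthesis M \<nu> \<Lambda> (D v) x = \<phi> x" for x
  proof (rule scalar_eqI_Re)
    fix c
    have "synthesis M \<nu> \<Lambda> (D v) (sX c x) = c * synthesis M \<nu> \<Lambda> (D v) x" "\<phi> (sX c x) = c * \<phi> x"
      using dual[of v] \<phi> by (auto simp: bounded_operators_def)
    then show "Re (cplx (c * synthesis M \<nu> \<Lambda> (D v) x)) = Re (cplx (c * \<phi> x))"
      using v[of "sX c x"] by (simp add: g_def)
  qed
  then show ?thesis
    using D by blast
qed

end


section \<open>Frame bounds from the synthesis operator\<close>

context operator_family
begin

lemma synthesis_surjective_bounded_if_bounds:
  assumes Lp: "\<And>x. (\<lambda>\<omega>. \<Lambda> \<omega> x) \<in> Lr M p"
    and A: "0 < A" and lower: "\<And>x. A * norm x \<le> Lr_norm M p (\<lambda>\<omega>. \<Lambda> \<omega> x)"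
    and B: "0 \<le> B" and upper: "\<And>x. Lr_norm M p (\<lambda>\<omega>. \<Lambda> \<omega> x) \<le> B * norm x"
  shows "synthesis_surjective_bounded M q sX sK \<nu> \<Lambda>"
proof -
  interpret bounded_bilinear "pairing \<nu>" by (rule bounded_bilinear_pairing)
  let ?T = "synthesis M \<nu> \<Lambda>"
  have int: "integrable (completion M) (\<lambda>\<omega>. pairing \<nu> (\<Lambda> \<omega> x) (G \<omega>))" if "G \<in> Lr M q" for G x
    by (rule integrable_pairing(1)[OF p pq Lp that])
  have dual: "?T G \<in> dual_space sX" if "G \<in> Lr M q" for G
    by (rule synthesis_dual(1)[OF Lp B upper that])
  have cong: "?T F = ?T G" if "F \<in> Lr M q" "G \<in> Lr M q" "AE \<omega> in M. F \<omega> = G \<omega>" for F G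
    unfolding synthesis_def
  proof (rule ext, rule integral_cong_AE)
    fix x
    have "AE \<omega> in completion M. F \<omega> = G \<omega>"
      using that(3) by (rule AE_completion)
    then show "AE \<omega> in completion M. pairing \<nu> (\<Lambda> \<omega> x) (F \<omega>) = pairing \<nu> (\<Lambda> \<omega> x) (G \<omega>)"
      by eventually_elim simp
  qed (use that int in \<open>auto dest: borel_measurable_integrable\<close>)
  have add: "?T (\<lambda>\<omega>. F \<omega> + G \<omega>) = (\<lambda>x. ?T F x + ?T G x)" if "F \<in> Lr M q" "G \<in> Lr M q" for F G
    using int[OF that(1)] int[OF that(2)] by (simp add: synthesis_def add_right)
  have scale: "?T (\<lambda>\<omega>. sK c (G \<omega>)) = (\<lambda>x. c * ?T G x)" for c G
    by (simp add: synthesis_def pairing_def pairing_sK_right)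
  have bound: "onorm (?T G) \<le> B * Lr_norm M q G" if "G \<in> Lr M q" for G
    by (rule synthesis_dual(2)[OF Lp B upper that])
  have "dual_space sX \<subseteq> ?T ` Lr M q"
    using synthesis_surjective[OF Lp A lower B upper] by blast
  then have "?T ` Lr M q = dual_space sX"
    using dual by blast
  moreover have "synthesis_well_defined M q sX \<nu> \<Lambda>"
    using int dual by (simp add: synthesis_well_defined_def)
  moreover have "bounded_operator_Lr_dual M q sK sX ?T"
    unfolding bounded_operator_Lr_dual_def using dual cong add scale bound by blast
  ultimately show ?thesis
    by (simp add: synthesis_surjective_bounded_def)
qed

text \<open>
  Let \<open>I\<close> be the integral of the \<open>p\<close>-th power of the norm of a truncation \<open>f\<close> of \<open>\<omega> \<mapsto> \<Lambda> \<omega> x\<close>, and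
  let \<open>G\<close> be the pointwise gradient of \<open>f\<close>. Then \<open>T G x = I\<close> while \<open>G\<close> has norm \<open>I\<^bsup>1/q\<^esup>\<close>, so
  \<open>I \<le> C * norm x * I\<^bsup>1/q\<^esup>\<close>. As \<open>I\<close> is finite, this bounds \<open>I\<^bsup>1/p\<^esup>\<close> by \<open>C * norm x\<close>, and
  monotone convergence removes the truncation.
\<close>

lemma upper_bound_if_synthesis_bounded:
  assumes "sigma_finite_measure M"
    and dual: "\<And>G. G \<in> Lr M q \<Longrightarrow> synthesis M \<nu> \<Lambda> G \<in> dual_space sX"
    and C: "0 \<le> C" and bound: "\<And>G. G \<in> Lr M q \<Longrightarrow> onorm (synthesis M \<nu> \<Lambda> G) \<le> C * Lr_norm M q G"
  shows "(\<lambda>\<omega>. \<Lambda> \<omega> x) \<in> Lr M p" and "Lr_norm M p (\<lambda>\<omega>. \<Lambda> \<omega> x) \<le> C * norm x"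
proof -
  interpret sigma_finite_measure M by (rule assms(1))
  interpret bounded_bilinear "pairing \<nu>" by (rule bounded_bilinear_pairing)
  let ?N = "completion M"
  define h where "h \<omega> = norm (\<Lambda> \<omega> x)" for \<omega>
  have h: "h \<in> borel_measurable ?N" "\<And>\<omega>. 0 \<le> h \<omega>"
    using borel_measurable_norm_powr(1)[OF measurable_family, of x] by (auto simp: h_def[abs_def])
  obtain A :: "nat \<Rightarrow> 'w set" where A: "range A \<subseteq> sets M" "(\<Union>i. A i) = space M"
      "\<And>i. emeasure M (A i) \<noteq> \<infinity>" "incseq A"
    by (rule sigma_finite_incseq) blast
  \<comment> \<open>On \<open>S n\<close> the function \<open>h\<close> is bounded and the measure is finite, so the truncation is in \<open>L\<^sup>p\<close>.\<close>
  define S where "S n = {\<omega> \<in> A n. h \<omega> \<le> real n}" for n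
  have S_eq: "S n = A n \<inter> {\<omega> \<in> space ?N. h \<omega> \<le> real n}" for n
    using sets.sets_into_space[of "A n" M] A(1) unfolding S_def by auto
  have A_meas: "A n \<in> sets ?N" "emeasure ?N (A n) \<noteq> \<infinity>" for n
    using A by auto
  have S: "S n \<in> sets ?N" for n
    unfolding S_eq using A_meas h(1) by measurable
  have S_fin: "emeasure ?N (S n) < \<infinity>" for n
  proof -
    have "emeasure ?N (S n) \<le> emeasure ?N (A n)"
      using A_meas by (intro emeasure_mono) (auto simp: S_def)
    also have "\<dots> < \<infinity>"
      using A_meas(2)[of n] by (simp add: less_top)
    finally show ?thesis .
  qed
  define f where "f n \<omega> = indicator (S n) \<omega> *\<^sub>R \<Lambda> \<omega> x" for n \<omega>
  have f_powr: "norm (f n \<omega>) powr p = indicator (S n) \<omega> * h \<omega> powr p" for n \<omega>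
    by (simp add: f_def h_def indicator_def)
  have bm_f: "bochner_measurable M (f n)" for n
  proof -
    have "bochner_measurable ?N (\<lambda>\<omega>. indicator (S n) \<omega> :: real)"
      using S by (intro bochner_measurable_borel borel_measurable_indicator)
    then show ?thesis
      unfolding f_def[abs_def] using measurable_family
      by (intro bochner_measurable_scaleR) (auto simp: bochner_measurable_completion_iff)
  qed
  have f: "f n \<in> Lr M p" for n
  proof -
    have "integrable ?N (\<lambda>\<omega>. norm (f n \<omega>) powr p)"
    proof (rule Bochner_Integration.integrable_bound)
      show "integrable ?N (\<lambda>\<omega>. real n powr p * indicator (S n) \<omega>)"
        using S S_fin by (intro integrable_mult_right integrable_real_indicator)
      show "AE \<omega> in ?N. norm (norm (f n \<omega>) powr p) \<le> norm (real n powr p * indicator (S n) \<omega> :: real)"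
        using p h(2) by (intro always_eventually allI)
          (auto simp: f_powr S_def indicator_def intro!: powr_mono2)
    qed (rule borel_measurable_norm_powr[OF bm_f])
    then show ?thesis
      using bm_f by (simp add: Lr_iff)
  qed
  define I where "I n = (\<integral>\<omega>. norm (f n \<omega>) powr p \<partial>?N)" for n
  have I0: "0 \<le> I n" for n
    by (simp add: I_def)
  have I_le: "I n powr (1 / p) \<le> C * norm x" for n
  proof (cases "I n = 0")
    case False
    define G where "G = (\<lambda>\<omega>. dual_power p (f n \<omega>))"
    have G: "G \<in> Lr M q" "Lr_norm M q G = I n powr (1 / q)"
      unfolding G_def I_def using Lr_dual_power[OF p pq f] by auto
    have "pairing \<nu> (\<Lambda> \<omega> x) (G \<omega>) = of_real (norm (f n \<omega>) powr p)" for \<omega>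
    proof (cases "\<omega> \<in> S n")
      case True
      then show ?thesis
        by (simp add: G_def f_def pairing_dual_power_self)
    next
      case False
      then show ?thesis
        by (simp add: G_def f_def dual_power_def zero_right)
    qed
    then have "synthesis M \<nu> \<Lambda> G x = (\<integral>\<omega>. of_real (norm (f n \<omega>) powr p) \<partial>?N)"
      by (simp only: synthesis_def)
    also have "\<dots> = of_real (I n)"
      unfolding I_def using f[of n]
      by (intro integral_bounded_linear[OF bounded_linear_of_real]) (simp add: Lr_iff)
    finally have "I n = norm (synthesis M \<nu> \<Lambda> G x)"
      using I0[of n] by (simp only: norm_of_real abs_of_nonneg)
    also have "\<dots> \<le> onorm (synthesis M \<nu> \<Lambda> G) * norm x"
      using dual[OF G(1)] by (intro onorm) (simp add: bounded_operators_def)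
    also have "\<dots> \<le> C * I n powr (1 / q) * norm x"
      using bound[OF G(1)] by (intro mult_right_mono) (auto simp: G(2))
    finally have le: "I n \<le> (C * norm x) * I n powr (1 / q)"
      by (simp add: ac_simps)
    have "I n powr (1 / p) * I n powr (1 / q) = I n"
      using False I0[of n] pq by (simp add: powr_add[symmetric])
    then have "I n powr (1 / p) * I n powr (1 / q) \<le> (C * norm x) * I n powr (1 / q)"
      using le by simp
    then show ?thesis
      using False by simp
  qed (use C in simp)
  define K where "K = (C * norm x) powr p"
  have I_le_K: "I n \<le> K" for n
  proof -
    have "(I n powr (1 / p)) powr p \<le> (C * norm x) powr p"
      using I_le p by (intro powr_mono2) auto
    then show ?thesis
      using I0[of n] p by (simp add: powr_powr K_def)
  qed
  have S_mono: "S m \<subseteq> S n" if "m \<le> n" for m n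
    using that incseqD[OF A(4) that] by (auto simp: S_def)
  have "(\<integral>\<^sup>+\<omega>. ennreal (h \<omega> powr p) \<partial>?N) \<le> (\<integral>\<^sup>+\<omega>. (SUP n. ennreal (norm (f n \<omega>) powr p)) \<partial>?N)"
  proof (rule nn_integral_mono)
    fix \<omega> assume "\<omega> \<in> space ?N"
    then obtain i where i: "\<omega> \<in> A i"
      using A(2) by auto
    obtain j :: nat where j: "h \<omega> \<le> real j"
      using real_arch_simple by blast
    have "\<omega> \<in> S (max i j)"
      using i j incseqD[OF A(4), of i "max i j"] by (auto simp: S_def)
    then have "ennreal (h \<omega> powr p) = ennreal (norm (f (max i j) \<omega>) powr p)"
      by (simp add: f_powr)
    also have "\<dots> \<le> (SUP n. ennreal (norm (f n \<omega>) powr p))"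
      by (rule SUP_upper) simp
    finally show "ennreal (h \<omega> powr p) \<le> (SUP n. ennreal (norm (f n \<omega>) powr p))" .
  qed
  also have "\<dots> = (SUP n. \<integral>\<^sup>+\<omega>. ennreal (norm (f n \<omega>) powr p) \<partial>?N)"
  proof (rule nn_integral_monotone_convergence_SUP)
    show "incseq (\<lambda>n \<omega>. ennreal (norm (f n \<omega>) powr p))"
      unfolding incseq_def le_fun_def f_powr using S_mono
      by (intro allI impI ennreal_leI mult_right_mono) (auto simp: indicator_def)
    show "(\<lambda>\<omega>. ennreal (norm (f n \<omega>) powr p)) \<in> borel_measurable ?N" for n
      using borel_measurable_norm_powr(2)[OF bm_f, of n p] by measurable
  qed
  also have "\<dots> \<le> ennreal K"
  proof (rule SUP_least)
    fix n
    have "(\<integral>\<^sup>+\<omega>. ennreal (norm (f n \<omega>) powr p) \<partial>?N) = ennreal (I n)"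
      unfolding I_def using f[of n] by (intro nn_integral_eq_integral) (auto simp: Lr_iff)
    then show "(\<integral>\<^sup>+\<omega>. ennreal (norm (f n \<omega>) powr p) \<partial>?N) \<le> ennreal K"
      using I_le_K by (simp add: ennreal_leI)
  qed
  finally have le: "(\<integral>\<^sup>+\<omega>. ennreal (norm (\<Lambda> \<omega> x) powr p) \<partial>?N) \<le> ennreal K"
    by (simp add: h_def)
  then show Lp: "(\<lambda>\<omega>. \<Lambda> \<omega> x) \<in> Lr M p"
    using measurable_family by (auto simp: Lr_def nn_integral_completion intro: order_le_less_trans)
  then have "ennreal (energy x) \<le> ennreal K"
    using le unfolding energy_def by (subst nn_integral_eq_integral[symmetric]) (auto simp: Lr_iff)
  then have "energy x \<le> K"
    by (simp add: K_def)
  then have "energy x powr (1 / p) \<le> K powr (1 / p)"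
    using p energy_nonneg by (intro powr_mono2) auto
  then show "Lr_norm M p (\<lambda>\<omega>. \<Lambda> \<omega> x) \<le> C * norm x"
    using p C by (simp add: Lr_norm_family K_def powr_powr)
qed

text \<open>
  If \<open>\<phi> = T G\<close>, then \<open>|\<phi> x|\<close> is at most the product of the \<open>L\<^sup>p\<close> norm of \<open>\<omega> \<mapsto> \<Lambda> \<omega> x\<close> and the
  \<open>L\<^sup>q\<close> norm of \<open>G\<close>. So the unit ball of the \<open>L\<^sup>p\<close> seminorm on \<open>X\<close> is weakly bounded, hence bounded,
  which by homogeneity is the lower bound.
\<close>

lemma lower_bound_if_synthesis_surjective:
  assumes Lp: "\<And>x. (\<lambda>\<omega>. \<Lambda> \<omega> x) \<in> Lr M p"
    and surj: "dual_space sX \<subseteq> synthesis M \<nu> \<Lambda> ` Lr M q"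
  shows "\<exists>A>0. \<forall>x. A * norm x \<le> Lr_norm M p (\<lambda>\<omega>. \<Lambda> \<omega> x)"
proof -
  define L where "L x = Lr_norm M p (\<lambda>\<omega>. \<Lambda> \<omega> x)" for x
  have "\<exists>C. \<forall>x\<in>{x. L x \<le> 1}. \<bar>f x\<bar> \<le> C" if f: "bounded_linear f" for f :: "'x \<Rightarrow> real"
  proof -
    obtain \<phi> where \<phi>: "\<phi> \<in> dual_space sX" "\<And>x. Re (cplx (\<phi> x)) = f x"
      using real_functional_lift[OF sX f] by blast
    obtain G where G: "G \<in> Lr M q" "\<phi> = synthesis M \<nu> \<Lambda> G"
      using surj \<phi>(1) by blast
    have "\<bar>f x\<bar> \<le> Lr_norm M q G" if "L x \<le> 1" for x
    proof -
      have "\<bar>f x\<bar> \<le> norm (\<phi> x)"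
        using abs_Re_le_cmod[of "cplx (\<phi> x)"] by (simp add: \<phi>(2) norm_cplx)
      also have "\<dots> \<le> L x * Lr_norm M q G"
        unfolding L_def G(2) synthesis_def by (rule integrable_pairing(2)[OF p pq Lp G(1)])
      also have "\<dots> \<le> 1 * Lr_norm M q G"
        using that by (intro mult_right_mono Lr_norm_nonneg)
      finally show ?thesis
        by simp
    qed
    then show ?thesis
      by blast
  qed
  then obtain R where R: "0 < R" "\<And>x. L x \<le> 1 \<Longrightarrow> norm x \<le> R"
    by (rule weakly_bounded_imp_bounded[of "{x. L x \<le> 1}"]) auto
  have L0: "0 \<le> L x" for x
    by (simp add: L_def Lr_norm_nonneg)
  have "norm x \<le> R * L x" for x
  proof (rule field_le_epsilon)
    fix e :: real
    assume e: "0 < e"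
    \<comment> \<open>The seminorm \<open>L x\<close> might vanish, so \<open>x\<close> is divided by a slightly larger number.\<close>
    define r where "r = L x + e / R"
    have r: "0 < r"
      using e R(1) L0[of x] by (simp add: r_def add_nonneg_pos)
    have "L ((1 / r) *\<^sub>R x) = L x / r"
      unfolding L_def Lr_norm_family_scaleR using r by simp
    also have "\<dots> \<le> 1"
      using r e R(1) by (simp add: r_def)
    finally have "norm ((1 / r) *\<^sub>R x) \<le> R"
      by (rule R(2))
    then have "norm x \<le> R * r"
      using r by (simp add: field_simps)
    then show "norm x \<le> R * L x + e"
      using R(1) by (simp add: r_def distrib_left)
  qed
  then have "(1 / R) * norm x \<le> L x" for x
    using R(1) by (simp add: field_simps)
  then show ?thesis
    using R(1) by (intro exI[of _ "1 / R"]) (simp add: L_def)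
qed

end


section \<open>The characterisation of Bochner pg-frames\<close>

theorem theorem2p13:
  fixes M :: "'w measure"
    and sX :: "'k::real_or_complex \<Rightarrow> 'x::banach \<Rightarrow> 'x"
    and sK :: "'k \<Rightarrow> 'h::banach \<Rightarrow> 'h"
    and ip :: "'h \<Rightarrow> 'h \<Rightarrow> 'k"
    and H :: "'w \<Rightarrow> 'h set"
    and \<nu> :: "'h \<Rightarrow> 'h \<Rightarrow> 'k"
    and \<Lambda> :: "'w \<Rightarrow> 'x \<Rightarrow> 'h"
    and p q :: real
  assumes X: "scalar_mult sX"
    and K: "scalar_mult sK" "inner_product sK ip" "hilbert_direct_sum sK ip (space M) H"
    and \<nu>: "isometric_iso_to_dual sK \<nu>"
    and p: "1 < p"
    and q: "1 / p + 1 / q = 1"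
    and \<Lambda>: "\<And>\<omega>. \<omega> \<in> space M \<Longrightarrow> \<Lambda> \<omega> \<in> bounded_operators sX sK (H \<omega>)"
  shows "(bochner_pg_frame M p sX sK H \<Lambda> \<longrightarrow> synthesis_surjective_bounded M q sX sK \<nu> \<Lambda>) \<and>
    (sigma_finite_measure M \<longrightarrow> (\<forall>x. bochner_measurable M (\<lambda>\<omega>. \<Lambda> \<omega> x)) \<longrightarrow>
       synthesis_surjective_bounded M q sX sK \<nu> \<Lambda> \<longrightarrow> bochner_pg_frame M p sX sK H \<Lambda>)"
proof -
  have family: "operator_family sK ip \<nu> M sX \<Lambda> p q" if "\<And>x. bochner_measurable M (\<lambda>\<omega>. \<Lambda> \<omega> x)"
    using X K(1,2) \<nu> p q \<Lambda> that
    by (intro operator_family.intro hilbert_pairing.intro operator_family_axioms.intro)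
      (simp_all add: bounded_operators_def)
  show ?thesis
  proof (intro conjI impI)
    assume frame: "bochner_pg_frame M p sX sK H \<Lambda>"
    then have meas: "bochner_measurable M (\<lambda>\<omega>. \<Lambda> \<omega> x)" for x
      by (simp add: bochner_pg_frame_def)
    interpret operator_family sK ip \<nu> M sX \<Lambda> p q
      by (rule family) (rule meas)
    obtain A B where AB: "0 < A" "0 < B"
      and bounds: "\<And>x. (\<integral>\<^sup>+\<omega>. ennreal (norm (\<Lambda> \<omega> x) powr p) \<partial>M) < \<infinity> \<and>
        A * norm x \<le> Lr_norm M p (\<lambda>\<omega>. \<Lambda> \<omega> x) \<and> Lr_norm M p (\<lambda>\<omega>. \<Lambda> \<omega> x) \<le> B * norm x"
      using frame unfolding bochner_pg_frame_def by blast
    show "synthesis_surjective_bounded M q sX sK \<nu> \<Lambda>"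
    proof (rule synthesis_surjective_bounded_if_bounds[where A = A and B = B])
      show "(\<lambda>\<omega>. \<Lambda> \<omega> x) \<in> Lr M p" for x
        using bounds meas by (simp add: Lr_def)
    qed (use AB bounds in auto)
  next
    assume sigma: "sigma_finite_measure M" and meas: "\<forall>x. bochner_measurable M (\<lambda>\<omega>. \<Lambda> \<omega> x)"
      and T: "synthesis_surjective_bounded M q sX sK \<nu> \<Lambda>"
    interpret operator_family sK ip \<nu> M sX \<Lambda> p q
      by (rule family) (use meas in blast)
    have dual: "synthesis M \<nu> \<Lambda> G \<in> dual_space sX" if "G \<in> Lr M q" for G
      using T that by (simp add: synthesis_surjective_bounded_def synthesis_well_defined_def)
    obtain C where C: "\<And>G. G \<in> Lr M q \<Longrightarrow> onorm (synthesis M \<nu> \<Lambda> G) \<le> C * Lr_norm M q G"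
      using T unfolding synthesis_surjective_bounded_def bounded_operator_Lr_dual_def by blast
    \<comment> \<open>The operator bound \<open>C\<close> need not be positive, as a frame bound must be.\<close>
    define B where "B = max C 1"
    have B: "0 < B"
      by (simp add: B_def)
    have "onorm (synthesis M \<nu> \<Lambda> G) \<le> B * Lr_norm M q G" if "G \<in> Lr M q" for G
      using C[OF that] mult_right_mono[of C B "Lr_norm M q G"] Lr_norm_nonneg[of M q G]
      by (simp add: B_def)
    note upper = upper_bound_if_synthesis_bounded[OF sigma dual less_imp_le[OF B] this]
    obtain A where A: "0 < A" "\<And>x. A * norm x \<le> Lr_norm M p (\<lambda>\<omega>. \<Lambda> \<omega> x)"
      using lower_bound_if_synthesis_surjective[OF upper(1)] T
      unfolding synthesis_surjective_bounded_def by blast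
    have "(\<integral>\<^sup>+\<omega>. ennreal (norm (\<Lambda> \<omega> x) powr p) \<partial>M) < \<infinity>" for x
      using upper(1)[of x] by (simp add: Lr_def)
    then have "\<exists>A>0. \<exists>B>0. \<forall>x.
        (\<integral>\<^sup>+\<omega>. ennreal (norm (\<Lambda> \<omega> x) powr p) \<partial>M) < \<infinity> \<and>
        A * norm x \<le> Lr_norm M p (\<lambda>\<omega>. \<Lambda> \<omega> x) \<and>
        Lr_norm M p (\<lambda>\<omega>. \<Lambda> \<omega> x) \<le> B * norm x"
      using A upper(2) B by (intro exI[of _ A] exI[of _ B] conjI allI)
    then show "bochner_pg_frame M p sX sK H \<Lambda>"
      unfolding bochner_pg_frame_def using \<Lambda> meas by (intro conjI ballI)
  qed
qed

end
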